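(* Let $n\ge 1$, let $V_i\simeq\mathbb{C}^2$ for $1\le i\le n$, and let $\varphi:\mathbb{P}(S^2\mathbb{C}^n\oplus\mathbb{C})\dashrightarrow\mathbb{P}(V_1^*\otimes\dots\otimes V_n^* )$ be the principal minor map. Then the tangential variety $\tau\left(\mathrm{Seg}(\mathbb{P}V_1^*\times\dots\times\mathbb{P}V_n^* )\right)$ is equal to the image (that is, the Zariski closure of the set-theoretic image) under $\varphi$ of the set of all $[A,t]$ with $t\ne 0$ and $A$ a symmetric $n\times n$ complex matrix of E-rank at most one.
   Context: $S^2\mathbb{C}^n$ is the space of symmetric $n\times n$ complex matrices. Fix a basis $\{x_i^0,x_i^1\}$ of $V_i^*$ for each $i$; for a binary multi-index $I=(i_1,\dots,i_n)\in\{0,1\}^n$ put $X^I=x_1^{i_1}\otimes\dots\otimes x_n^{i_n}$ and $|I|=\sum_k i_k$. Let $\Delta_I(A)$ be the principal minor of $A$ on the rows and columns $k$ with $i_k=1$ (equal to $1$ for $I=0$). The principal minor map is $\varphi([A,t])=\left[\sum_I t^{n-|I|}\Delta_I(A)X^I\right]$, considered on the open set $t\neq0$. An exclusive minor (E-minor) of a matrix $A$ is a minor whose row index set $I$ and column index set $J$ satisfy $I\cap J=\emptyset$. The exclusive rank (E-rank) of $A$ is the minimal $k\ge 0$ such that all $(k+1)\times(k+1)$ E-minors of $A$ vanish. The Segre variety $\mathrm{Seg}(\mathbb{P}V_1^*\times\dots\times\mathbb{P}V_n^* )$ is the set of points $[v_1\otimes\dots\otimes v_n]$ with $0\ne v_i\in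 V_i^*$. For a smooth projective variety $X\subset\mathbb{P}V$, the tangential variety $\tau(X)$ is the union of all points on all embedded tangent lines to $X$. *)

theory Defs
  imports
    Complex_Main
    "HOL-Library.Poly_Mapping"
    "Jordan_Normal_Form.DL_Submatrix"
    "Jordan_Normal_Form.Determinant"
begin

text \<open>
  The factors \<open>V\<^sub>i\<^sup>*\<close> are numbered \<open>i = 0, \<dots>, n - 1\<close>. A multi-index
  \<open>(i\<^sub>0, \<dots>, i\<^bsub>n-1\<^esub>) \<in> {0,1}\<^sup>n\<close> is represented by its support \<open>{k. i\<^sub>k = 1} \<subseteq> {..<n}\<close>, and a tensor
  by its family of coordinates in the basis \<open>(X\<^sup>I)\<close>, extended by zero to all of \<^typ>\<open>nat set\<close>.
\<close>

type_synonym tensor = "nat set \<Rightarrow> complex"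

definition tensor_space :: "nat \<Rightarrow> tensor set" where
  "tensor_space n = {x. \<forall>I. \<not> I \<subseteq> {..<n} \<longrightarrow> x I = 0}"

definition lincomb :: "complex \<Rightarrow> tensor \<Rightarrow> complex \<Rightarrow> tensor \<Rightarrow> tensor" where
  "lincomb a x b y = (\<lambda>I. a * x I + b * y I)"

text \<open>
  A point \<open>[x]\<close> of a projective space is the set of all nonzero multiples of a nonzero vector \<open>x\<close>.
  Hence \<open>\<Union>S\<close> is the affine cone over a set \<open>S\<close> of points, with the origin removed.
\<close>

definition proj_point :: "tensor \<Rightarrow> tensor set" where
  "proj_point x = {(\<lambda>I. c * x I) | c. c \<noteq> 0}"

definition proj_space :: "nat \<Rightarrow> tensor set set" where
  "proj_space n = {proj_point x | x. x \<in> tensor_space n \<and> x \<noteq> (\<lambda>_. 0)}"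

text \<open>
  Polynomials in the coordinates of tensors: the monomials are finitely supported exponent
  families.
\<close>

type_synonym coord_poly = "(nat set \<Rightarrow>\<^sub>0 nat) \<Rightarrow>\<^sub>0 complex"

definition poly_eval :: "coord_poly \<Rightarrow> tensor \<Rightarrow> complex" where
  "poly_eval p x =
    (\<Sum>m\<in>Poly_Mapping.keys p. Poly_Mapping.lookup p m *
      (\<Prod>I\<in>Poly_Mapping.keys m. x I ^ Poly_Mapping.lookup m I))"

definition forms :: "nat \<Rightarrow> coord_poly set" where
  "forms n = {p. \<exists>d. \<forall>m\<in>Poly_Mapping.keys p.
     Poly_Mapping.keys m \<subseteq> Pow {..<n} \<and> (\<Sum>I\<in>Poly_Mapping.keys m. Poly_Mapping.lookup m I) = d}"

definition vanishing_forms :: "nat \<Rightarrow> tensor set set \<Rightarrow> coord_poly set" where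
  "vanishing_forms n S = {p \<in> forms n. \<forall>x\<in>\<Union>S. poly_eval p x = 0}"

definition zariski_closure :: "nat \<Rightarrow> tensor set set \<Rightarrow> tensor set set" where
  "zariski_closure n S = {P \<in> proj_space n. \<forall>p\<in>vanishing_forms n S. \<forall>x\<in>P. poly_eval p x = 0}"

text \<open>
  The affine tangent space of the cone over \<open>X\<close> at \<open>x\<close>: the vectors annihilated by the
  differentials at \<open>x\<close> of all forms vanishing on \<open>X\<close>. The embedded tangent lines to \<open>X\<close> at \<open>[x]\<close>
  are the projective lines through \<open>[x]\<close> in the projectivisation of this space.
\<close>

definition affine_tangent_space :: "nat \<Rightarrow> tensor set set \<Rightarrow> tensor \<Rightarrow> tensor set" where
  "affine_tangent_space n X x = {w \<in> tensor_space n. \<forall>p\<in>vanishing_forms n X.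
     ((\<lambda>s. poly_eval p (lincomb 1 x s w)) has_field_derivative 0) (at 0)}"

definition proj_line :: "tensor \<Rightarrow> tensor \<Rightarrow> tensor set set" where
  "proj_line x w = {proj_point (lincomb a x b w) | a b. lincomb a x b w \<noteq> (\<lambda>_. 0)}"

definition embedded_tangent_lines :: "nat \<Rightarrow> tensor set set \<Rightarrow> tensor set set set" where
  "embedded_tangent_lines n X = {proj_line x w | x w.
     x \<in> \<Union>X \<and> w \<in> affine_tangent_space n X x \<and>
     (\<forall>a b. lincomb a x b w = (\<lambda>_. 0) \<longrightarrow> a = 0 \<and> b = 0)}"

definition tangential_variety :: "nat \<Rightarrow> tensor set set \<Rightarrow> tensor set set" where
  "tangential_variety n X = \<Union>(embedded_tangent_lines n X)"

text \<open>The pair \<open>v i = (a, b)\<close> stands for \<open>a x\<^sub>i\<^sup>0 + b x\<^sub>i\<^sup>1 \<in> V\<^sub>i\<^sup>*\<close>.\<close>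

definition pure_tensor :: "nat \<Rightarrow> (nat \<Rightarrow> complex \<times> complex) \<Rightarrow> tensor" where
  "pure_tensor n v =
    (\<lambda>I. if I \<subseteq> {..<n} then \<Prod>i<n. if i \<in> I then snd (v i) else fst (v i) else 0)"

definition segre_variety :: "nat \<Rightarrow> tensor set set" where
  "segre_variety n = {proj_point (pure_tensor n v) | v. \<forall>i<n. v i \<noteq> (0, 0)}"

definition minor_det :: "complex mat \<Rightarrow> nat set \<Rightarrow> nat set \<Rightarrow> complex" where
  "minor_det A I J = det (submatrix A I J)"

definition E_minors_vanish :: "complex mat \<Rightarrow> nat \<Rightarrow> bool" where
  "E_minors_vanish A k \<longleftrightarrow> (\<forall>I J. I \<subseteq> {..<dim_row A} \<longrightarrow> J \<subseteq> {..<dim_col A} \<longrightarrow>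
     card I = k \<longrightarrow> card J = k \<longrightarrow> I \<inter> J = {} \<longrightarrow> minor_det A I J = 0)"

definition E_rank :: "complex mat \<Rightarrow> nat" where
  "E_rank A = (LEAST k. E_minors_vanish A (k + 1))"

definition symmetric_mats :: "nat \<Rightarrow> complex mat set" where
  "symmetric_mats n = {A \<in> carrier_mat n n. transpose_mat A = A}"

text \<open>Points \<open>[A, t]\<close> of \<open>\<P>(S\<^sup>2\<complex>\<^sup>n \<oplus> \<complex>)\<close>.\<close>

definition proj_pair :: "complex mat \<Rightarrow> complex \<Rightarrow> (complex mat \<times> complex) set" where
  "proj_pair A t = {(c \<cdot>\<^sub>m A, c * t) | c. c \<noteq> 0}"

definition principal_minor_tensor :: "nat \<Rightarrow> complex mat \<Rightarrow> complex \<Rightarrow> tensor" where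
  "principal_minor_tensor n A t =
    (\<lambda>I. if I \<subseteq> {..<n} then t ^ (n - card I) * minor_det A I I else 0)"

text \<open>
  The map on projective points, given by representatives; the union is over equal sets, see
  \<open>principal_minor_map_proj_pair\<close> below. It is only applied to points with \<open>t \<noteq> 0\<close>.
\<close>

definition principal_minor_map :: "nat \<Rightarrow> (complex mat \<times> complex) set \<Rightarrow> tensor set" where
  "principal_minor_map n P = (\<Union>(A, t)\<in>P. proj_point (principal_minor_tensor n A t))"

lemma minor_det_smult:
  assumes "A \<in> carrier_mat n n" "I \<subseteq> {..<n}"
  shows "minor_det (c \<cdot>\<^sub>m A) I I = c ^ card I * minor_det A I I"
proof -
  have eq: "{i. i < n \<and> i \<in> I} = I" using assms by auto
  have "submatrix (c \<cdot>\<^sub>m A) I I = c \<cdot>\<^sub>m submatrix A I I"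
  proof (rule eq_matI)
    fix i j
    assume "i < dim_row (c \<cdot>\<^sub>m submatrix A I I)" "j < dim_col (c \<cdot>\<^sub>m submatrix A I I)"
    then have ij: "i < card I" "j < card I" using assms eq by (auto simp: dim_submatrix)
    have "pick I i \<in> I" "pick I j \<in> I" using ij by (auto intro: pick_in_set_le)
    then have "pick I i < n" "pick I j < n" using assms by auto
    then show "submatrix (c \<cdot>\<^sub>m A) I I $$ (i, j) = (c \<cdot>\<^sub>m submatrix A I I) $$ (i, j)"
      using ij assms eq by (simp add: submatrix_def)
  qed (auto simp: dim_submatrix)
  then show ?thesis
    using assms eq by (simp add: minor_det_def det_smult dim_submatrix)
qed

lemma proj_point_scale:
  assumes "c \<noteq> 0"
  shows "proj_point (\<lambda>I. c * x I) = proj_point x"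
proof -
  have "\<exists>e. e \<noteq> 0 \<and> (\<lambda>I. d * x I) = (\<lambda>I. e * (c * x I))" if "d \<noteq> 0" for d
    using that assms by (intro exI[of _ "d / c"]) auto
  moreover have "\<exists>e. e \<noteq> 0 \<and> (\<lambda>I. d * (c * x I)) = (\<lambda>I. e * x I)" if "d \<noteq> 0" for d
    using that assms by (intro exI[of _ "d * c"]) auto
  ultimately show ?thesis unfolding proj_point_def by fastforce
qed

lemma principal_minor_map_proj_pair:
  assumes "A \<in> carrier_mat n n"
  shows "principal_minor_map n (proj_pair A t) = proj_point (principal_minor_tensor n A t)"
proof -
  have "principal_minor_tensor n (c \<cdot>\<^sub>m A) (c * t) = (\<lambda>I. c ^ n * principal_minor_tensor n A t I)"
    for c
  proof
    fix I
    show "principal_minor_tensor n (c \<cdot>\<^sub>m A) (c * t) I = c ^ n * principal_minor_tensor n A t I"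
    proof (cases "I \<subseteq> {..<n}")
      case True
      then have "card I \<le> n" using card_mono[of "{..<n}" I] by simp
      then have "c ^ n = c ^ (n - card I) * c ^ card I" by (simp flip: power_add)
      then show ?thesis
        using True by (simp add: principal_minor_tensor_def minor_det_smult[OF assms True]
            power_mult_distrib)
    qed (simp add: principal_minor_tensor_def)
  qed
  then have "proj_point (principal_minor_tensor n (c \<cdot>\<^sub>m A) (c * t)) =
      proj_point (principal_minor_tensor n A t)" if "c \<noteq> 0" for c
    using that by (simp add: proj_point_scale)
  moreover have "principal_minor_map n (proj_pair A t) =
      (\<Union>c\<in>{c. c \<noteq> 0}. proj_point (principal_minor_tensor n (c \<cdot>\<^sub>m A) (c * t)))"
    by (auto simp: principal_minor_map_def proj_pair_def)
  moreover have "{c :: complex. c \<noteq> 0} \<noteq> {}"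
    using one_neq_zero by blast
  ultimately show ?thesis by auto
qed

end

theory Submission
  imports Defs
begin

text \<open>
  A tensor is regarded as a multilinear form on \<open>V\<^sub>0 \<times> \<dots> \<times> V\<^bsub>n-1\<^esub>\<close>. The vectors of the affine cone
  over the tangential variety are the forms
  \<open>T(\<phi>) = \<Sum>\<^sub>i \<langle>\<phi>\<^sub>i, w\<^sub>i\<rangle> \<Prod>\<^bsub>k \<noteq> i\<^esub> \<langle>\<phi>\<^sub>k, v\<^sub>k\<rangle>\<close>, equivalently the forms that vanish as soon as two of
  the \<open>\<phi>\<^sub>k\<close> are annihilated by \<open>v\<^sub>k\<close>. For generic \<open>v\<close>, \<open>w\<close> they are, up to scaling, the tensors of
  principal minors of matrices \<open>D + u u\<^sup>T\<close>, and a symmetric matrix of E-rank at most one is of this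
  form or a limit of such matrices; so the same forms vanish on both sets.

  It remains to see that the cone is Zariski closed, that is, to recover \<open>v\<close> polynomially from \<open>T\<close>.
  Contracting \<open>T\<close> with \<open>\<phi>\<close> in all factors but \<open>i\<close>, \<open>j\<close> gives a \<open>2 \<times> 2\<close> matrix whose determinant, for
  \<open>T\<close> as above, is a constant multiple of \<open>\<Prod>\<^bsub>k \<noteq> i, j\<^esub> \<langle>\<phi>\<^sub>k, v\<^sub>k\<rangle>\<^sup>2\<close>. If all these determinants vanish
  identically, then \<open>T\<close> is a pure tensor. Otherwise one of them determines \<open>v\<^sub>k\<close> for \<open>k \<noteq> i, j\<close>, and the
  vanishing conditions on \<open>T\<close> become equations in its coordinates.
\<close>

section \<open>Tensors as multilinear forms\<close>

text \<open>The pairing of a vector of \<open>V_k\<close>, the first argument, with an element of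
  the dual, the second. It is bilinear, without complex conjugation.\<close>

definition dot :: "complex \<times> complex \<Rightarrow> complex \<times> complex \<Rightarrow> complex" where
  "dot x v = fst x * fst v + snd x * snd v"

definition vcomb :: "complex \<Rightarrow> complex \<times> complex \<Rightarrow> complex \<Rightarrow> complex \<times> complex \<Rightarrow> complex \<times> complex" where
  "vcomb a x b y = (a * fst x + b * fst y, a * snd x + b * snd y)"

text \<open>Here \<open>pure_tensor n \<phi>\<close> holds the coordinates of a product of vectors
  \<open>\<phi> k\<close> of \<open>V_k\<close>, so the sum is the full contraction of
  \<open>T\<close> with them. The argument works with these values, which are free of coordinates
  and linear in every \<open>\<phi> k\<close>.\<close>

definition ev :: "nat \<Rightarrow> tensor \<Rightarrow> (nat \<Rightarrow> complex \<times> complex) \<Rightarrow> complex" where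
  "ev n T \<phi> = (\<Sum>I\<in>Pow {..<n}. T I * pure_tensor n \<phi> I)"

lemma dot_vcomb: "dot (vcomb a x b y) v = a * dot x v + b * dot y v"
  by (simp add: dot_def vcomb_def algebra_simps)

lemma pure_tensor_cong:
  assumes "\<And>k. k < n \<Longrightarrow> v k = w k"
  shows "pure_tensor n v = pure_tensor n w"
  using assms by (auto simp: pure_tensor_def fun_eq_iff intro!: prod.cong)

lemma pure_tensor_upd:
  assumes "k < n" "I \<subseteq> {..<n}"
  shows "pure_tensor n (v(k := x)) I = (if k \<in> I then snd x else fst x) *
    (\<Prod>i\<in>{..<n} - {k}. if i \<in> I then snd (v i) else fst (v i))"
proof -
  have "pure_tensor n (v(k := x)) I = (\<Prod>i<n. if i \<in> I then snd ((v(k := x)) i) else fst ((v(k := x)) i))"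
    using assms by (simp add: pure_tensor_def)
  also have "\<dots> = (if k \<in> I then snd x else fst x) *
    (\<Prod>i\<in>{..<n} - {k}. if i \<in> I then snd ((v(k := x)) i) else fst ((v(k := x)) i))"
    using assms by (subst prod.remove[of _ k]) auto
  also have "(\<Prod>i\<in>{..<n} - {k}. if i \<in> I then snd ((v(k := x)) i) else fst ((v(k := x)) i)) =
    (\<Prod>i\<in>{..<n} - {k}. if i \<in> I then snd (v i) else fst (v i))"
    by (intro prod.cong) auto
  finally show ?thesis .
qed

lemma pure_tensor_upd_linear:
  assumes "k < n"
  shows "pure_tensor n (v(k := vcomb a x b y)) I =
    a * pure_tensor n (v(k := x)) I + b * pure_tensor n (v(k := y)) I"
proof (cases "I \<subseteq> {..<n}")
  case True
  then show ?thesis using assms by (simp add: pure_tensor_upd vcomb_def algebra_simps)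
qed (simp add: pure_tensor_def)

lemma ev_cong:
  assumes "\<And>k. k < n \<Longrightarrow> \<phi> k = \<psi> k"
  shows "ev n T \<phi> = ev n T \<psi>"
  using pure_tensor_cong[OF assms] by (simp add: ev_def)

lemma ev_upd_linear:
  assumes "k < n"
  shows "ev n T (\<phi>(k := vcomb a x b y)) = a * ev n T (\<phi>(k := x)) + b * ev n T (\<phi>(k := y))"
  using assms by (simp add: ev_def pure_tensor_upd_linear sum_distrib_left sum.distrib algebra_simps)

lemma ev_upd_basis:
  assumes "k < n"
  shows "ev n T (\<phi>(k := x)) = fst x * ev n T (\<phi>(k := (1, 0))) + snd x * ev n T (\<phi>(k := (0, 1)))"
proof -
  have "x = vcomb (fst x) (1, 0) (snd x) (0, 1)" by (simp add: vcomb_def)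
  then show ?thesis using ev_upd_linear[OF assms] by metis
qed

lemma ev_lincomb: "ev n (lincomb a S b T) \<phi> = a * ev n S \<phi> + b * ev n T \<phi>"
  by (simp add: ev_def lincomb_def sum_distrib_left sum.distrib algebra_simps)

lemma ev_scale: "ev n (\<lambda>I. c * T I) \<phi> = c * ev n T \<phi>"
  by (simp add: ev_def sum_distrib_left algebra_simps)

lemma ev_sum: "ev n (\<lambda>I. \<Sum>i\<in>A. T i I) \<phi> = (\<Sum>i\<in>A. ev n (T i) \<phi>)"
  by (simp add: ev_def sum_distrib_right sum.swap[of _ A])

text \<open>Multiplying out the product, \<open>I\<close> is the set of factors that contribute the
  term with the second coordinates.\<close>

lemma ev_pure: "ev n (pure_tensor n v) \<phi> = (\<Prod>k<n. dot (\<phi> k) (v k))"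
proof -
  have *: "(\<Prod>i\<in>{..<n}. if i \<in> I then f i else g i) = prod f I * prod g ({..<n} - I)"
    if "I \<subseteq> {..<n}" for I and f g :: "nat \<Rightarrow> complex"
  proof -
    have "{..<n} \<inter> {x. x \<in> I} = I" "{..<n} \<inter> {x. x \<notin> I} = {..<n} - I" using that by auto
    then show ?thesis by (simp add: prod.If_cases Compl_eq)
  qed
  have "ev n (pure_tensor n v) \<phi> = (\<Sum>I\<in>Pow {..<n}. (\<Prod>k\<in>I. snd (\<phi> k) * snd (v k)) *
      (\<Prod>k\<in>{..<n} - I. fst (\<phi> k) * fst (v k)))"
    by (auto simp: ev_def pure_tensor_def * prod.distrib intro!: sum.cong)
  also have "\<dots> = (\<Prod>k<n. snd (\<phi> k) * snd (v k) + fst (\<phi> k) * fst (v k))"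
    by (rule prod_add[symmetric]) simp
  finally show ?thesis by (simp add: dot_def add.commute)
qed

lemma ev_coord:
  assumes "I \<subseteq> {..<n}"
  shows "ev n T (\<lambda>k. if k \<in> I then (0, 1) else (1, 0)) = T I"
proof -
  have "pure_tensor n (\<lambda>k. if k \<in> I then (0, 1) else (1, 0)) J = (if J = I then 1 else 0)"
    if "J \<subseteq> {..<n}" for J
  proof (cases "J = I")
    case False
    then obtain k where k: "(k \<in> J) \<noteq> (k \<in> I)" by blast
    moreover have "k < n" using k that assms by auto
    ultimately have "(\<Prod>i<n. if i \<in> J then snd (if i \<in> I then (0, 1) else (1::complex, 0::complex))
        else fst (if i \<in> I then (0, 1) else (1, 0))) = (0::complex)"
      by (intro prod_zero) auto
    then show ?thesis using that False by (simp add: pure_tensor_def)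
  next
    case True
    then show ?thesis using that by (auto simp: pure_tensor_def intro!: prod.neutral)
  qed
  then have "ev n T (\<lambda>k. if k \<in> I then (0, 1) else (1, 0)) = (\<Sum>J\<in>Pow {..<n}. T J * (if J = I then 1 else 0))"
    by (simp add: ev_def)
  also have "\<dots> = T I" using assms by (simp add: if_distrib cong: if_cong)
  finally show ?thesis .
qed

lemma tensor_eqI:
  assumes "S \<in> tensor_space n" "T \<in> tensor_space n" "\<And>\<phi>. ev n S \<phi> = ev n T \<phi>"
  shows "S = T"
proof
  fix I show "S I = T I"
    using assms ev_coord[of I n S] ev_coord[of I n T] by (cases "I \<subseteq> {..<n}") (auto simp: tensor_space_def)
qed

section \<open>Forms\<close>

text \<open>Homogeneous polynomial functions as a closure system: explicit equations are recognised
  as forms by introduction rules, and \<open>form_fun_imp_form\<close> turns them into polynomials.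
  The clause \<open>zero\<close> gives the zero function every degree, which empty sums
  require.\<close>

inductive form_fun :: "nat \<Rightarrow> nat \<Rightarrow> (tensor \<Rightarrow> complex) \<Rightarrow> bool" for n where
  coord: "I \<subseteq> {..<n} \<Longrightarrow> form_fun n 1 (\<lambda>T. T I)"
| const: "form_fun n 0 (\<lambda>_. c)"
| zero: "form_fun n d (\<lambda>_. 0)"
| add: "form_fun n d f \<Longrightarrow> form_fun n d g \<Longrightarrow> form_fun n d (\<lambda>T. f T + g T)"
| mult: "form_fun n d f \<Longrightarrow> form_fun n e g \<Longrightarrow> form_fun n (d + e) (\<lambda>T. f T * g T)"

lemma form_fun_cmult: "form_fun n d f \<Longrightarrow> form_fun n d (\<lambda>T. c * f T)"
  using form_fun.mult[OF form_fun.const] by fastforce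

lemma form_fun_uminus: "form_fun n d f \<Longrightarrow> form_fun n d (\<lambda>T. - f T)"
  using form_fun_cmult[of n d f "-1"] by simp

lemma form_fun_diff: "form_fun n d f \<Longrightarrow> form_fun n d g \<Longrightarrow> form_fun n d (\<lambda>T. f T - g T)"
  using form_fun.add[OF _ form_fun_uminus, of n d f g] by simp

lemma form_fun_sum:
  assumes "\<And>i. i \<in> A \<Longrightarrow> form_fun n d (f i)"
  shows "form_fun n d (\<lambda>T. \<Sum>i\<in>A. f i T)"
  using assms by (induction A rule: infinite_finite_induct) (auto intro: form_fun.intros)

lemma form_fun_prod:
  assumes "finite A" "\<And>i. i \<in> A \<Longrightarrow> form_fun n (d i) (f i)"
  shows "form_fun n (sum d A) (\<lambda>T. \<Prod>i\<in>A. f i T)"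
  using assms by (induction A rule: finite_induct) (auto intro: form_fun.intros)

section \<open>Evaluation as a ring homomorphism on polynomials\<close>

definition monom_eval :: "(nat set \<Rightarrow>\<^sub>0 nat) \<Rightarrow> tensor \<Rightarrow> complex" where
  "monom_eval m x = (\<Prod>I\<in>Poly_Mapping.keys m. x I ^ Poly_Mapping.lookup m I)"

text \<open>Cancellation can make the support of a sum smaller than the union of the supports.
  Summing over a common finite superset avoids tracking this, since absent monomials have
  coefficient 0.\<close>

lemma poly_eval_superset:
  assumes "finite A" "Poly_Mapping.keys p \<subseteq> A"
  shows "poly_eval p x = (\<Sum>m\<in>A. Poly_Mapping.lookup p m * monom_eval m x)"
  unfolding poly_eval_def monom_eval_def using assms
  by (intro sum.mono_neutral_left) (auto simp: in_keys_iff)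

lemma monom_eval_superset:
  assumes "finite A" "Poly_Mapping.keys m \<subseteq> A"
  shows "monom_eval m x = (\<Prod>I\<in>A. x I ^ Poly_Mapping.lookup m I)"
  unfolding monom_eval_def using assms
  by (intro prod.mono_neutral_left) (auto simp: in_keys_iff)

lemma monom_eval_add: "monom_eval (m + m') x = monom_eval m x * monom_eval m' x"
proof -
  let ?A = "Poly_Mapping.keys m \<union> Poly_Mapping.keys m'"
  have "Poly_Mapping.keys (m + m') \<subseteq> ?A" by (rule Poly_Mapping.keys_add)
  then show ?thesis
    by (simp add: monom_eval_superset[of ?A] lookup_add power_add prod.distrib)
qed

lemma poly_eval_add: "poly_eval (p + q) x = poly_eval p x + poly_eval q x"
proof -
  let ?A = "Poly_Mapping.keys p \<union> Poly_Mapping.keys q"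
  have "Poly_Mapping.keys (p + q) \<subseteq> ?A" by (rule Poly_Mapping.keys_add)
  then show ?thesis
    by (simp add: poly_eval_superset[of ?A] lookup_add distrib_right sum.distrib)
qed

lemma poly_eval_zero: "poly_eval 0 x = 0"
  by (simp add: poly_eval_def)

lemma poly_eval_single: "poly_eval (Poly_Mapping.single m c) x = c * monom_eval m x"
  by (subst poly_eval_superset[of "{m}"]) auto

lemma poly_eval_sum: "poly_eval (\<Sum>i\<in>A. p i) x = (\<Sum>i\<in>A. poly_eval (p i) x)"
  by (induction A rule: infinite_finite_induct) (auto simp: poly_eval_zero poly_eval_add)

lemma poly_mapping_sum_single:
  "(\<Sum>m\<in>Poly_Mapping.keys p. Poly_Mapping.single m (Poly_Mapping.lookup p m)) = p"
  by (rule poly_mapping_eqI) (simp add: lookup_sum lookup_single when_def in_keys_iff)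

lemma poly_eval_mult: "poly_eval (p * q) x = poly_eval p x * poly_eval q x"
proof -
  have "p * q = (\<Sum>m\<in>Poly_Mapping.keys p. Poly_Mapping.single m (Poly_Mapping.lookup p m)) *
      (\<Sum>m\<in>Poly_Mapping.keys q. Poly_Mapping.single m (Poly_Mapping.lookup q m))"
    by (simp add: poly_mapping_sum_single)
  also have "poly_eval \<dots> x = poly_eval p x * poly_eval q x"
    by (simp add: sum_product mult_single poly_eval_sum poly_eval_single monom_eval_add
        poly_eval_superset[of "Poly_Mapping.keys p"] poly_eval_superset[of "Poly_Mapping.keys q"] mult_ac)
  finally show ?thesis .
qed

text \<open>The induction carries the degree of every monomial along, because membership in
  \<open>forms\<close> asks for one common degree. In a product each monomial is a sum
  \<open>a + b\<close> of exponents of monomials from the two factors.\<close>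

lemma form_fun_imp_form:
  assumes "form_fun n d f"
  shows "\<exists>p. (\<forall>m\<in>Poly_Mapping.keys p. Poly_Mapping.keys m \<subseteq> Pow {..<n} \<and>
      (\<Sum>I\<in>Poly_Mapping.keys m. Poly_Mapping.lookup m I) = d) \<and> poly_eval p = f"
    (is "\<exists>p. ?form d p \<and> _")
  using assms
proof induction
  case (coord I)
  show ?case
    by (rule exI[of _ "Poly_Mapping.single (Poly_Mapping.single I 1) 1"])
      (use coord in \<open>auto simp: poly_eval_single monom_eval_def\<close>)
next
  case (const c)
  show ?case
    by (rule exI[of _ "Poly_Mapping.single 0 c"])
      (auto simp: poly_eval_single monom_eval_def)
next
  case (zero d)
  show ?case by (rule exI[of _ 0]) (auto simp: poly_eval_zero)
next
  case (add d f g)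
  then obtain p q where pq: "?form d p" "poly_eval p = f" "?form d q" "poly_eval q = g" by auto
  have "?form d (p + q)" using pq Poly_Mapping.keys_add[of p q] by blast
  then show ?case using pq by (intro exI[of _ "p + q"]) (simp add: poly_eval_add fun_eq_iff)
next
  case (mult d f e g)
  then obtain p q where pq: "?form d p" "poly_eval p = f" "?form e q" "poly_eval q = g" by auto
  have "Poly_Mapping.keys m \<subseteq> Pow {..<n} \<and>
      (\<Sum>I\<in>Poly_Mapping.keys m. Poly_Mapping.lookup m I) = d + e"
    if m: "m \<in> Poly_Mapping.keys (p * q)" for m
  proof -
    obtain a b where ab: "m = a + b" "a \<in> Poly_Mapping.keys p" "b \<in> Poly_Mapping.keys q"
      using m keys_mult[of p q] by blast
    let ?A = "Poly_Mapping.keys a \<union> Poly_Mapping.keys b"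
    have sub: "Poly_Mapping.keys m \<subseteq> ?A" unfolding ab by (rule Poly_Mapping.keys_add)
    \<comment> \<open>The supports of \<open>m\<close>, \<open>a\<close> and \<open>b\<close>
      differ; over the common index set \<open>?A\<close> the degree is additive.\<close>
    have *: "(\<Sum>I\<in>Poly_Mapping.keys c. Poly_Mapping.lookup c I) = (\<Sum>I\<in>?A. Poly_Mapping.lookup c I)"
      if "Poly_Mapping.keys c \<subseteq> ?A" for c :: "nat set \<Rightarrow>\<^sub>0 nat"
      using that by (intro sum.mono_neutral_left) (auto simp: in_keys_iff)
    have "(\<Sum>I\<in>?A. Poly_Mapping.lookup m I) = (\<Sum>I\<in>?A. Poly_Mapping.lookup a I) + (\<Sum>I\<in>?A. Poly_Mapping.lookup b I)"
      by (simp add: ab lookup_add sum.distrib)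
    also have "\<dots> = d + e"
      using pq ab *[of a] *[of b] by auto
    finally have "(\<Sum>I\<in>Poly_Mapping.keys m. Poly_Mapping.lookup m I) = d + e"
      using *[OF sub] by simp
    moreover have "Poly_Mapping.keys m \<subseteq> Pow {..<n}" using pq(1,3) ab(2,3) sub by blast
    ultimately show ?thesis by blast
  qed
  then show ?case using pq(2,4)
    by (intro exI[of _ "p * q"]) (simp add: poly_eval_mult fun_eq_iff)
qed

lemma form_fun_vanishing:
  assumes "form_fun n d f" "\<And>T. T \<in> \<Union>S \<Longrightarrow> f T = 0"
  obtains p where "p \<in> vanishing_forms n S" "poly_eval p = f"
proof -
  obtain p where "\<forall>m\<in>Poly_Mapping.keys p. Poly_Mapping.keys m \<subseteq> Pow {..<n} \<and>
      (\<Sum>I\<in>Poly_Mapping.keys m. Poly_Mapping.lookup m I) = d" "poly_eval p = f"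
    using form_fun_imp_form[OF assms(1)] by blast
  then show ?thesis using assms(2) by (intro that[of p]) (auto simp: vanishing_forms_def forms_def)
qed

text \<open>The arguments may themselves be forms in \<open>T\<close>. This produces the equations
  obtained by substituting vectors computed from \<open>T\<close> back into
  \<open>T\<close>.\<close>

lemma form_fun_ev:
  assumes "\<And>k. k < n \<Longrightarrow> form_fun n (e k) (\<lambda>T. fst (\<Phi> T k))"
    "\<And>k. k < n \<Longrightarrow> form_fun n (e k) (\<lambda>T. snd (\<Phi> T k))"
  shows "form_fun n (1 + (\<Sum>k<n. e k)) (\<lambda>T. ev n T (\<Phi> T))"
proof -
  have "form_fun n (1 + (\<Sum>k<n. e k)) (\<lambda>T. T I * pure_tensor n (\<Phi> T) I)" if "I \<in> Pow {..<n}" for I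
  proof -
    have "form_fun n (e k) (\<lambda>T. if k \<in> I then snd (\<Phi> T k) else fst (\<Phi> T k))" if "k < n" for k
      using assms[OF that] by (cases "k \<in> I") auto
    then have "form_fun n (\<Sum>k<n. e k) (\<lambda>T. \<Prod>k<n. if k \<in> I then snd (\<Phi> T k) else fst (\<Phi> T k))"
      by (intro form_fun_prod) auto
    then show ?thesis
      using that form_fun.mult[OF form_fun.coord[of I n]] by (simp add: pure_tensor_def)
  qed
  then show ?thesis unfolding ev_def by (rule form_fun_sum)
qed

lemma form_fun_ev_const: "form_fun n 1 (\<lambda>T. ev n T \<phi>)"
  using form_fun_ev[of n "\<lambda>_. 0" "\<lambda>_. \<phi>"] by (auto intro: form_fun.const)

text \<open>By the chain rule the derivative depends only on the point and the velocity.
  \<open>D\<close> is obtained before the curve, so that a curve inside a variety can be compared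
  with the straight line of the same velocity.\<close>

lemma poly_eval_curve_derivative:
  obtains D where "\<And>\<gamma>. \<gamma> 0 = x \<Longrightarrow> (\<And>I. ((\<lambda>s. \<gamma> s I) has_field_derivative w I) (at 0)) \<Longrightarrow>
    ((\<lambda>s. poly_eval p (\<gamma> s)) has_field_derivative D) (at 0)"
proof (rule that)
  fix \<gamma> :: "complex \<Rightarrow> tensor"
  assume \<gamma>: "\<gamma> 0 = x" "\<And>I. ((\<lambda>s. \<gamma> s I) has_field_derivative w I) (at 0)"
  show "((\<lambda>s. poly_eval p (\<gamma> s)) has_field_derivative
    (\<Sum>m\<in>Poly_Mapping.keys p. Poly_Mapping.lookup p m *
      (\<Sum>I\<in>Poly_Mapping.keys m. of_nat (Poly_Mapping.lookup m I) *
        (w I * x I ^ (Poly_Mapping.lookup m I - Suc 0)) *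
        (\<Prod>J\<in>Poly_Mapping.keys m - {I}. x J ^ Poly_Mapping.lookup m J)))) (at 0)"
    unfolding poly_eval_def \<gamma>(1)[symmetric]
    by (rule DERIV_sum DERIV_cmult has_field_derivative_prod DERIV_power \<gamma>(2))+
qed

lemma tendsto_poly_eval:
  assumes "\<And>I. ((\<lambda>s. \<gamma> s I) \<longlongrightarrow> x I) F"
  shows "((\<lambda>s. poly_eval p (\<gamma> s)) \<longlongrightarrow> poly_eval p x) F"
  unfolding poly_eval_def by (intro tendsto_intros assms)

section \<open>Tangent tensors\<close>

text \<open>The derivative at \<open>s = 0\<close> of the pure tensor with factors
  \<open>v k + s * w k\<close>.\<close>

definition tangent_tensor :: "nat \<Rightarrow> (nat \<Rightarrow> complex \<times> complex) \<Rightarrow> (nat \<Rightarrow> complex \<times> complex) \<Rightarrow> tensor" where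
  "tangent_tensor n v w = (\<lambda>I. \<Sum>i<n. pure_tensor n (v(i := w i)) I)"

lemma tangent_tensor_in_space: "tangent_tensor n v w \<in> tensor_space n"
  by (simp add: tangent_tensor_def tensor_space_def pure_tensor_def)

lemma ev_tangent_tensor:
  "ev n (tangent_tensor n v w) \<phi> =
    (\<Sum>i<n. dot (\<phi> i) (w i) * (\<Prod>k\<in>{..<n} - {i}. dot (\<phi> k) (v k)))"
proof -
  have "(\<Prod>k<n. dot (\<phi> k) ((v(i := w i)) k)) =
      dot (\<phi> i) (w i) * (\<Prod>k\<in>{..<n} - {i}. dot (\<phi> k) (v k))" if "i < n" for i
  proof -
    have "(\<Prod>k<n. dot (\<phi> k) ((v(i := w i)) k)) =
        dot (\<phi> i) (w i) * (\<Prod>k\<in>{..<n} - {i}. dot (\<phi> k) ((v(i := w i)) k))"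
      using that by (subst prod.remove[of _ i]) auto
    also have "(\<Prod>k\<in>{..<n} - {i}. dot (\<phi> k) ((v(i := w i)) k)) = (\<Prod>k\<in>{..<n} - {i}. dot (\<phi> k) (v k))"
      by (intro prod.cong) auto
    finally show ?thesis .
  qed
  then show ?thesis by (simp add: tangent_tensor_def ev_sum ev_pure)
qed

text \<open>Each summand replaces only one factor \<open>v i\<close>, so at least one of the two
  vanishing pairings survives in it.\<close>

lemma ev_tangent_tensor_eq_0:
  assumes "k < n" "l < n" "k \<noteq> l" "dot (\<phi> k) (v k) = 0" "dot (\<phi> l) (v l) = 0"
  shows "ev n (tangent_tensor n v w) \<phi> = 0"
proof -
  have "(\<Prod>m\<in>{..<n} - {i}. dot (\<phi> m) (v m)) = 0" for i
    using assms by (cases "i = k") (auto intro: prod_zero)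
  then have "(\<Sum>i<n. dot (\<phi> i) (w i) * (\<Prod>k\<in>{..<n} - {i}. dot (\<phi> k) (v k))) = 0"
    by (intro sum.neutral) (simp del: prod_zero_iff)
  then show ?thesis by (simp only: ev_tangent_tensor)
qed

text \<open>The summands that differentiate a factor other than \<open>i\<close> and
  \<open>j\<close> share \<open>dot a (v i) * dot b (v j)\<close>; \<open>R\<close> collects what is
  left of them. It is obtained before \<open>a\<close> and \<open>b\<close>, so all entries of the
  contracted matrix use the same \<open>R\<close>.\<close>

lemma ev_tangent_tensor_upd2:
  fixes v w \<phi> :: "nat \<Rightarrow> complex \<times> complex"
  assumes "i < n" "j < n" "i \<noteq> j"
  obtains R where "\<And>a b. ev n (tangent_tensor n v w) (\<phi>(i := a, j := b)) =
    dot a (v i) * dot b (v j) * R +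
    (dot a (w i) * dot b (v j) + dot a (v i) * dot b (w j)) * (\<Prod>k\<in>{..<n} - {i, j}. dot (\<phi> k) (v k))"
proof (rule that)
  fix a b
  let ?\<phi> = "\<phi>(i := a, j := b)"
  let ?O = "{..<n} - {i, j}"
  have O: "(\<Prod>k\<in>?O - A. dot (?\<phi> k) (v k)) = (\<Prod>k\<in>?O - A. dot (\<phi> k) (v k))" for A
    by (intro prod.cong) auto
  have "(\<Sum>l<n. dot (?\<phi> l) (w l) * (\<Prod>k\<in>{..<n} - {l}. dot (?\<phi> k) (v k))) =
    dot a (w i) * (\<Prod>k\<in>{..<n} - {i}. dot (?\<phi> k) (v k)) +
    (dot b (w j) * (\<Prod>k\<in>{..<n} - {j}. dot (?\<phi> k) (v k)) +
    (\<Sum>l\<in>?O. dot (?\<phi> l) (w l) * (\<Prod>k\<in>{..<n} - {l}. dot (?\<phi> k) (v k))))"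
    using assms by (subst sum.remove[of _ i], simp, simp, subst sum.remove[of _ j])
      (auto simp: Diff_insert2[symmetric] insert_commute)
  also have "(\<Prod>k\<in>{..<n} - {i}. dot (?\<phi> k) (v k)) = dot b (v j) * (\<Prod>k\<in>?O. dot (\<phi> k) (v k))"
    using assms O[of "{}"] by (subst prod.remove[of _ j]) (auto simp: Diff_insert2[symmetric] insert_commute)
  also have "(\<Prod>k\<in>{..<n} - {j}. dot (?\<phi> k) (v k)) = dot a (v i) * (\<Prod>k\<in>?O. dot (\<phi> k) (v k))"
    using assms O[of "{}"] by (subst prod.remove[of _ i]) (auto simp: Diff_insert2[symmetric] insert_commute)
  also have "(\<Sum>l\<in>?O. dot (?\<phi> l) (w l) * (\<Prod>k\<in>{..<n} - {l}. dot (?\<phi> k) (v k))) =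
    (\<Sum>l\<in>?O. dot a (v i) * dot b (v j) * (dot (\<phi> l) (w l) * (\<Prod>k\<in>?O - {l}. dot (\<phi> k) (v k))))"
  proof (rule sum.cong[OF refl])
    fix l assume l: "l \<in> ?O"
    have "{..<n} - {l} = insert i (insert j (?O - {l}))" using l assms by auto
    then have "(\<Prod>k\<in>{..<n} - {l}. dot (?\<phi> k) (v k)) =
      dot a (v i) * (dot b (v j) * (\<Prod>k\<in>?O - {l}. dot (?\<phi> k) (v k)))"
      using assms by simp
    then show "dot (?\<phi> l) (w l) * (\<Prod>k\<in>{..<n} - {l}. dot (?\<phi> k) (v k)) =
      dot a (v i) * dot b (v j) * (dot (\<phi> l) (w l) * (\<Prod>k\<in>?O - {l}. dot (\<phi> k) (v k)))"
      using l O[of "{l}"] by simp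
  qed
  finally show "ev n (tangent_tensor n v w) ?\<phi> = dot a (v i) * dot b (v j) *
      (\<Sum>l\<in>?O. dot (\<phi> l) (w l) * (\<Prod>k\<in>?O - {l}. dot (\<phi> k) (v k))) +
    (dot a (w i) * dot b (v j) + dot a (v i) * dot b (w j)) * (\<Prod>k\<in>?O. dot (\<phi> k) (v k))"
    unfolding ev_tangent_tensor by (simp only: sum_distrib_left algebra_simps)
qed

lemma dot_basis: "dot (1, 0) v = fst v" "dot (0, 1) v = snd v"
  by (simp_all add: dot_def)

text \<open>Each argument is split as \<open>\<mu> k\<close> times \<open>p k\<close> plus a
  remainder \<open>\<xi> k\<close> annihilated by \<open>v k\<close>. In the multilinear expansion
  of \<open>T\<close> the terms with two or more remainders vanish, and those with at most one have
  the shape of a tangent tensor.\<close>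

lemma tangent_tensorI:
  fixes p v :: "nat \<Rightarrow> complex \<times> complex"
  assumes "n \<ge> 1" "T \<in> tensor_space n" and p: "\<And>k. k < n \<Longrightarrow> dot (p k) (v k) = 1"
    and ann: "\<And>\<psi> k l. k < n \<Longrightarrow> l < n \<Longrightarrow> k \<noteq> l \<Longrightarrow> dot (\<psi> k) (v k) = 0 \<Longrightarrow>
      dot (\<psi> l) (v l) = 0 \<Longrightarrow> ev n T \<psi> = 0"
  shows "\<exists>w. T = tangent_tensor n v w"
proof -
  \<comment> \<open>Away from index 0, \<open>w i\<close> sees only the remainder part of its
    argument. The term of the expansion without remainders must be counted exactly once; it is
    stored in \<open>w 0\<close>, which is where \<open>n \<ge> 1\<close> enters.\<close>
  define w where "w i = (ev n T (p(i := (1, 0))) - fst (v i) * ev n T p + (if i = 0 then fst (v i) * ev n T p else 0),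
    ev n T (p(i := (0, 1))) - snd (v i) * ev n T p + (if i = 0 then snd (v i) * ev n T p else 0))" for i
  have w: "dot x (w i) = ev n T (p(i := x)) - dot x (v i) * ev n T p + (if i = 0 then dot x (v i) * ev n T p else 0)"
    if "i < n" for i x
    using ev_upd_basis[OF that, of T p x] by (simp add: w_def dot_def algebra_simps)
  have "ev n T \<phi> = ev n (tangent_tensor n v w) \<phi>" for \<phi>
  proof -
    define \<mu> where "\<mu> k = dot (\<phi> k) (v k)" for k
    define \<xi> where "\<xi> k = vcomb 1 (\<phi> k) (- \<mu> k) (p k)" for k
    \<comment> \<open>The factors are expanded one at a time: in \<open>G m\<close> the first
      \<open>m\<close> arguments have already been replaced by \<open>p\<close>.\<close>
    define G where "G m = (\<lambda>k. if k < m then p k else \<phi> k)" for m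
    have \<phi>: "\<phi> k = vcomb (\<mu> k) (p k) 1 (\<xi> k)" for k
      by (simp add: \<xi>_def vcomb_def)
    have \<xi>: "dot (\<xi> k) (v k) = 0" if "k < n" for k
      by (simp add: \<xi>_def dot_vcomb p that \<mu>_def)
    have "ev n T \<phi> = (\<Prod>k<m. \<mu> k) * ev n T (G m) +
        (\<Sum>i<m. (\<Prod>k\<in>{..<m} - {i}. \<mu> k) * ev n T ((G m)(i := \<xi> i)))" if "m \<le> n" for m
      using that
    proof (induction m)
      case 0
      then show ?case by (simp add: G_def)
    next
      case (Suc m)
      then have m: "m < n" by simp
      have split: "ev n T (\<psi>(m := \<phi> m)) = \<mu> m * ev n T (\<psi>(m := p m)) + ev n T (\<psi>(m := \<xi> m))" for \<psi>
        by (subst \<phi>) (simp add: ev_upd_linear[OF m])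
      have G: "(G m)(m := p m) = G (Suc m)" "(G m)(m := \<phi> m) = G m"
        "(G m)(m := \<xi> m) = (G (Suc m))(m := \<xi> m)"
        by (auto simp: G_def fun_eq_iff)
      have first: "ev n T (G m) = \<mu> m * ev n T (G (Suc m)) + ev n T ((G (Suc m))(m := \<xi> m))"
        using split[of "G m"] by (simp add: G)
      have second: "ev n T ((G m)(i := \<xi> i)) = \<mu> m * ev n T ((G (Suc m))(i := \<xi> i))" if "i < m" for i
      proof -
        have "ev n T ((G m)(i := \<xi> i)) = ev n T ((G m)(i := \<xi> i, m := \<phi> m))"
          using that by (simp add: fun_upd_twist[of m] fun_upd_twist[of i] G)
        also have "\<dots> = \<mu> m * ev n T ((G m)(i := \<xi> i, m := p m)) + ev n T ((G m)(i := \<xi> i, m := \<xi> m))"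
          by (rule split)
        also have "ev n T ((G m)(i := \<xi> i, m := \<xi> m)) = 0"
          using that m by (intro ann[of i m]) (auto simp: \<xi>)
        also have "(G m)(i := \<xi> i, m := p m) = (G (Suc m))(i := \<xi> i)"
          using that by (auto simp: G_def fun_eq_iff)
        finally show ?thesis by (simp only: add_0_right)
      qed
      have third: "(\<Prod>k\<in>{..<Suc m} - {i}. \<mu> k) = \<mu> m * (\<Prod>k\<in>{..<m} - {i}. \<mu> k)" if "i < m" for i
      proof -
        have "{..<Suc m} - {i} = insert m ({..<m} - {i})" using that by auto
        then show ?thesis by simp
      qed
      have fourth: "{..<Suc m} - {m} = {..<m}" by auto
      have "ev n T \<phi> = (\<Prod>k<m. \<mu> k) * ev n T (G m) +
        (\<Sum>i<m. (\<Prod>k\<in>{..<m} - {i}. \<mu> k) * ev n T ((G m)(i := \<xi> i)))"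
        using m by (intro Suc.IH) simp
      also have "\<dots> = (\<Prod>k<Suc m. \<mu> k) * ev n T (G (Suc m)) + (\<Prod>k<m. \<mu> k) * ev n T ((G (Suc m))(m := \<xi> m)) +
        (\<Sum>i<m. (\<Prod>k\<in>{..<Suc m} - {i}. \<mu> k) * ev n T ((G (Suc m))(i := \<xi> i)))"
        by (simp add: first second third algebra_simps)
      finally show ?case by (simp add: fourth algebra_simps del: fun_upd_apply)
    qed
    from this[of n] have "ev n T \<phi> = (\<Prod>k<n. \<mu> k) * ev n T (G n) +
        (\<Sum>i<n. (\<Prod>k\<in>{..<n} - {i}. \<mu> k) * ev n T ((G n)(i := \<xi> i)))" by simp
    moreover have "ev n T (G n) = ev n T p" by (rule ev_cong) (simp add: G_def)
    moreover have "ev n T ((G n)(i := \<xi> i)) = dot (\<phi> i) (w i) - (if i = 0 then \<mu> i * ev n T p else 0)" if "i < n" for i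
    proof -
      have "ev n T ((G n)(i := \<xi> i)) = ev n T (p(i := \<xi> i))" by (rule ev_cong) (simp add: G_def)
      then show ?thesis by (simp add: \<xi>_def ev_upd_linear[OF that] w[OF that] \<mu>_def)
    qed
    moreover have "(\<Sum>i<n. (\<Prod>k\<in>{..<n} - {i}. \<mu> k) * (dot (\<phi> i) (w i) - (if i = 0 then \<mu> i * ev n T p else 0))) =
      ev n (tangent_tensor n v w) \<phi> - (\<Sum>i<n. if i = 0 then (\<Prod>k\<in>{..<n} - {i}. \<mu> k) * (\<mu> i * ev n T p) else 0)"
      unfolding ev_tangent_tensor sum_subtractf[symmetric]
      by (intro sum.cong) (auto simp: \<mu>_def algebra_simps)
    moreover have "(\<Sum>i<n. if i = 0 then (\<Prod>k\<in>{..<n} - {i}. \<mu> k) * (\<mu> i * ev n T p) else 0) = (\<Prod>k<n. \<mu> k) * ev n T p"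
      using assms(1) prod.remove[of "{..<n}" 0 \<mu>] by simp
    ultimately show ?thesis by simp
  qed
  then have "T = tangent_tensor n v w"
    by (intro tensor_eqI[OF assms(2) tangent_tensor_in_space])
  then show ?thesis by blast
qed

text \<open>Any other argument is a multiple of \<open>p m\<close> plus a vector annihilated by
  \<open>v m\<close>, so multilinearity reduces to arguments of these two kinds. The induction is
  over a set containing the factors not yet of either kind.\<close>

lemma annihilation_reduction:
  fixes p v :: "nat \<Rightarrow> complex \<times> complex"
  assumes p: "\<And>k. k < n \<Longrightarrow> dot (p k) (v k) = 1"
    and red: "\<And>\<psi>. (\<And>m. m < n \<Longrightarrow> \<psi> m = p m \<or> dot (\<psi> m) (v m) = 0) \<Longrightarrow>
      dot (\<psi> k) (v k) = 0 \<Longrightarrow> dot (\<psi> l) (v l) = 0 \<Longrightarrow> ev n T \<psi> = 0"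
    and "dot (\<psi> k) (v k) = 0" "dot (\<psi> l) (v l) = 0"
  shows "ev n T \<psi> = 0"
proof -
  have "ev n T \<psi> = 0" if "finite S" "\<And>m. m < n \<Longrightarrow> m \<notin> S \<Longrightarrow> \<psi> m = p m \<or> dot (\<psi> m) (v m) = 0"
    "dot (\<psi> k) (v k) = 0" "dot (\<psi> l) (v l) = 0" for S \<psi>
    using that
  proof (induction S arbitrary: \<psi> rule: finite_induct)
    case empty
    then show ?case using red by simp
  next
    case (insert m S)
    show ?case
    proof (cases "m < n \<and> dot (\<psi> m) (v m) \<noteq> 0")
      case False
      show ?thesis by (rule insert.IH) (use False insert.prems in auto)
    next
      case True
      let ?\<xi> = "vcomb 1 (\<psi> m) (- dot (\<psi> m) (v m)) (p m)"
      have "\<psi> m = vcomb (dot (\<psi> m) (v m)) (p m) 1 ?\<xi>" by (simp add: vcomb_def)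
      then have "ev n T \<psi> = ev n T (\<psi>(m := vcomb (dot (\<psi> m) (v m)) (p m) 1 ?\<xi>))" by simp
      also have "\<dots> = dot (\<psi> m) (v m) * ev n T (\<psi>(m := p m)) + ev n T (\<psi>(m := ?\<xi>))"
        using True by (simp add: ev_upd_linear)
      also have "ev n T (\<psi>(m := p m)) = 0"
        by (rule insert.IH) (use True insert.prems in auto)
      also have "ev n T (\<psi>(m := ?\<xi>)) = 0"
        by (rule insert.IH) (use True insert.prems p in \<open>auto simp: dot_vcomb\<close>)
      finally show ?thesis by simp
    qed
  qed
  from this[of "{..<n}"] show ?thesis using assms by auto
qed

lemma exists_dot_eq_1:
  assumes "v \<noteq> (0, 0)"
  shows "\<exists>x. dot x v = 1"
proof (cases "fst v = 0")
  case True
  then have "dot (0, 1 / snd v) v = 1" using assms by (cases v) (simp add: dot_def)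
  then show ?thesis by blast
next
  case False
  then have "dot (1 / fst v, 0) v = 1" by (simp add: dot_def)
  then show ?thesis by blast
qed

section \<open>Closedness of the set of tangent tensors\<close>

lemma ev_upd2_basis:
  assumes "i < n" "j < n" "i \<noteq> j"
  shows "ev n T (\<phi>(i := a, j := b)) =
    fst a * fst b * ev n T (\<phi>(i := (1, 0), j := (1, 0))) +
    fst a * snd b * ev n T (\<phi>(i := (1, 0), j := (0, 1))) +
    snd a * fst b * ev n T (\<phi>(i := (0, 1), j := (1, 0))) +
    snd a * snd b * ev n T (\<phi>(i := (0, 1), j := (0, 1)))"
proof -
  have "ev n T (\<phi>(i := a, j := x)) = fst a * ev n T (\<phi>(i := (1, 0), j := x)) + snd a * ev n T (\<phi>(i := (0, 1), j := x))" for x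
    using ev_upd_basis[OF assms(1), of T "\<phi>(j := x)" a] assms(3) by (simp add: fun_upd_twist)
  then show ?thesis
    by (subst ev_upd_basis[OF assms(2)]) (simp add: algebra_simps)
qed

text \<open>The polarisation of the determinant, for the \<open>2 \<times> 2\<close> matrices obtained by contracting a
  tensor with \<open>\<phi>\<close>, respectively \<open>\<psi>\<close>, in all factors but \<open>i\<close> and \<open>j\<close>.\<close>

definition mixed_disc :: "nat \<Rightarrow> nat \<Rightarrow> nat \<Rightarrow> tensor \<Rightarrow> (nat \<Rightarrow> complex \<times> complex) \<Rightarrow> (nat \<Rightarrow> complex \<times> complex) \<Rightarrow> complex" where
  "mixed_disc n i j T \<phi> \<psi> =
    ev n T (\<phi>(i := (1, 0), j := (1, 0))) * ev n T (\<psi>(i := (0, 1), j := (0, 1))) +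
    ev n T (\<phi>(i := (0, 1), j := (0, 1))) * ev n T (\<psi>(i := (1, 0), j := (1, 0))) -
    ev n T (\<phi>(i := (1, 0), j := (0, 1))) * ev n T (\<psi>(i := (0, 1), j := (1, 0))) -
    ev n T (\<phi>(i := (0, 1), j := (1, 0))) * ev n T (\<psi>(i := (1, 0), j := (0, 1)))"

text \<open>A change of the pair of vectors in factor \<open>i\<close> or \<open>j\<close>
  multiplies a \<open>2 x 2\<close> determinant by the determinant of that pair, and polarisation
  preserves this rule.\<close>

lemma mixed_disc_vectors:
  assumes "i < n" "j < n" "i \<noteq> j"
  shows "ev n T (\<phi>(i := a, j := b)) * ev n T (\<psi>(i := a', j := b')) +
    ev n T (\<phi>(i := a', j := b')) * ev n T (\<psi>(i := a, j := b)) -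
    ev n T (\<phi>(i := a, j := b')) * ev n T (\<psi>(i := a', j := b)) -
    ev n T (\<phi>(i := a', j := b)) * ev n T (\<psi>(i := a, j := b')) =
    (fst a * snd a' - snd a * fst a') * (fst b * snd b' - snd b * fst b') * mixed_disc n i j T \<phi> \<psi>"
proof -
  note * = ev_upd2_basis[OF assms, of T _ a b] ev_upd2_basis[OF assms, of T _ a b']
    ev_upd2_basis[OF assms, of T _ a' b] ev_upd2_basis[OF assms, of T _ a' b']
  show ?thesis unfolding * mixed_disc_def by (simp add: algebra_simps)
qed

lemma mixed_disc_upd_linear:
  assumes "k < n" "k \<noteq> i" "k \<noteq> j"
  shows "mixed_disc n i j T (\<phi>(k := x)) \<psi> =
    fst x * mixed_disc n i j T (\<phi>(k := (1, 0))) \<psi> + snd x * mixed_disc n i j T (\<phi>(k := (0, 1))) \<psi>"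
proof -
  have *: "ev n T (\<phi>(k := x, i := a, j := b)) = fst x * ev n T (\<phi>(k := (1, 0), i := a, j := b)) +
    snd x * ev n T (\<phi>(k := (0, 1), i := a, j := b))" for a b
    using ev_upd_basis[OF assms(1), of T "\<phi>(i := a, j := b)" x] assms(2,3)
    by (simp add: fun_upd_twist[of k])
  show ?thesis unfolding mixed_disc_def *[of "(1, 0)"] *[of "(0, 1)"] by (simp add: algebra_simps)
qed

text \<open>For a tangent tensor, \<open>mixed_disc n i j T (p(k := x)) p\<close> is proportional to
  \<open>dot x (v k)\<close> as a function of \<open>x\<close>. Subtracting the right multiple of
  \<open>p k\<close> from a multiple of \<open>x\<close> thus gives a vector annihilated by
  \<open>v k\<close>. No division occurs, so the result is quadratic in \<open>T\<close> and can be
  used inside forms.\<close>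

definition kernel_vec :: "nat \<Rightarrow> nat \<Rightarrow> nat \<Rightarrow> (nat \<Rightarrow> complex \<times> complex) \<Rightarrow> nat \<Rightarrow> complex \<times> complex \<Rightarrow> tensor \<Rightarrow> complex \<times> complex" where
  "kernel_vec n i j p k x T =
    vcomb (mixed_disc n i j T p p) x (- mixed_disc n i j T (p(k := x)) p) (p k)"

text \<open>Relative to \<open>v i, w i\<close> and \<open>v j, w j\<close> the contracted matrix is
  \<open>[[R, Q], [Q, 0]]\<close>, with \<open>Q\<close> the product over the other factors. Its
  polarised determinant does not involve \<open>R\<close>.\<close>

lemma mixed_disc_tangent_tensor:
  fixes v w :: "nat \<Rightarrow> complex \<times> complex"
  assumes "i < n" "j < n" "i \<noteq> j"
  obtains c where "\<And>\<phi> \<psi>. mixed_disc n i j (tangent_tensor n v w) \<phi> \<psi> =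
    c * (\<Prod>k\<in>{..<n} - {i, j}. dot (\<phi> k) (v k)) * (\<Prod>k\<in>{..<n} - {i, j}. dot (\<psi> k) (v k))"
proof (rule that)
  fix \<phi> \<psi> :: "nat \<Rightarrow> complex \<times> complex"
  obtain R where R: "\<And>a b. ev n (tangent_tensor n v w) (\<phi>(i := a, j := b)) =
    dot a (v i) * dot b (v j) * R +
    (dot a (w i) * dot b (v j) + dot a (v i) * dot b (w j)) * (\<Prod>k\<in>{..<n} - {i, j}. dot (\<phi> k) (v k))"
    using ev_tangent_tensor_upd2[OF assms] by blast
  obtain R' where R': "\<And>a b. ev n (tangent_tensor n v w) (\<psi>(i := a, j := b)) =
    dot a (v i) * dot b (v j) * R' +
    (dot a (w i) * dot b (v j) + dot a (v i) * dot b (w j)) * (\<Prod>k\<in>{..<n} - {i, j}. dot (\<psi> k) (v k))"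
    using ev_tangent_tensor_upd2[OF assms] by blast
  show "mixed_disc n i j (tangent_tensor n v w) \<phi> \<psi> =
    (- 2 * (fst (v i) * snd (w i) - snd (v i) * fst (w i)) * (fst (v j) * snd (w j) - snd (v j) * fst (w j))) *
    (\<Prod>k\<in>{..<n} - {i, j}. dot (\<phi> k) (v k)) * (\<Prod>k\<in>{..<n} - {i, j}. dot (\<psi> k) (v k))"
    unfolding mixed_disc_def R R' dot_basis by (simp add: algebra_simps)
qed

lemma dot_kernel_vec_tangent_tensor:
  assumes "i < n" "j < n" "i \<noteq> j" "k < n" "k \<noteq> i" "k \<noteq> j"
  shows "dot (kernel_vec n i j p k x (tangent_tensor n v w)) (v k) = 0"
proof -
  obtain c where c: "\<And>\<phi> \<psi>. mixed_disc n i j (tangent_tensor n v w) \<phi> \<psi> =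
    c * (\<Prod>k\<in>{..<n} - {i, j}. dot (\<phi> k) (v k)) * (\<Prod>k\<in>{..<n} - {i, j}. dot (\<psi> k) (v k))"
    using mixed_disc_tangent_tensor[OF assms(1-3)] by blast
  let ?P = "\<Prod>m\<in>{..<n} - {i, j} - {k}. dot (p m) (v m)"
  have *: "(\<Prod>m\<in>{..<n} - {i, j}. dot ((p(k := y)) m) (v m)) = dot y (v k) * ?P" for y
  proof -
    have "(\<Prod>m\<in>{..<n} - {i, j}. dot ((p(k := y)) m) (v m)) =
        dot y (v k) * (\<Prod>m\<in>{..<n} - {i, j} - {k}. dot ((p(k := y)) m) (v m))"
      using assms by (subst prod.remove[of _ k]) auto
    also have "(\<Prod>m\<in>{..<n} - {i, j} - {k}. dot ((p(k := y)) m) (v m)) = ?P"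
      by (intro prod.cong) auto
    finally show ?thesis .
  qed
  show ?thesis
    unfolding kernel_vec_def dot_vcomb c * using *[of "p k"] by simp
qed

lemma form_fun_mixed_disc: "form_fun n 2 (\<lambda>T. mixed_disc n i j T \<phi> \<psi>)"
proof -
  have "form_fun n 2 (\<lambda>T. ev n T a * ev n T b)" for a b
    using form_fun.mult[OF form_fun_ev_const form_fun_ev_const, of n a b] by (simp add: numeral_2_eq_2)
  then show ?thesis unfolding mixed_disc_def
    by (intro form_fun_diff form_fun.add)
qed

lemma form_fun_kernel_vec:
  "form_fun n 2 (\<lambda>T. fst (kernel_vec n i j p k x T))"
  "form_fun n 2 (\<lambda>T. snd (kernel_vec n i j p k x T))"
proof -
  have *: "form_fun n 2 (\<lambda>T. mixed_disc n i j T \<phi> \<psi> * c)" for \<phi> \<psi> c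
    using form_fun_cmult[OF form_fun_mixed_disc] by (simp add: mult.commute)
  show "form_fun n 2 (\<lambda>T. fst (kernel_vec n i j p k x T))" "form_fun n 2 (\<lambda>T. snd (kernel_vec n i j p k x T))"
    by (auto simp: kernel_vec_def vcomb_def intro!: form_fun_diff *)
qed

text \<open>The Zariski closure of the cone of tangent tensors, phrased with polynomial functions so
  that each explicit equation can be transferred to \<open>T\<close> directly.\<close>

definition in_tangent_closure :: "nat \<Rightarrow> tensor \<Rightarrow> bool" where
  "in_tangent_closure n T \<longleftrightarrow> T \<in> tensor_space n \<and>
    (\<forall>d f. form_fun n d f \<longrightarrow> (\<forall>v w. f (tangent_tensor n v w) = 0) \<longrightarrow> f T = 0)"

lemma tangent_closureD:
  assumes "in_tangent_closure n T" "form_fun n d f" "\<And>v w. f (tangent_tensor n v w) = 0"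
  shows "f T = 0"
  using assms unfolding in_tangent_closure_def by blast

text \<open>For tangent tensors two factors are annihilated, by the choice of kernel vectors. As an
  equation of degree 5 in \<open>T\<close> this persists on the closure.\<close>

lemma closure_kernel_vec2:
  assumes T: "in_tangent_closure n T" and ij: "i < n" "j < n" "i \<noteq> j"
    and kl: "k < n" "k \<noteq> i" "k \<noteq> j" "l < n" "l \<noteq> i" "l \<noteq> j" "k \<noteq> l"
  shows "ev n T (\<phi>(k := kernel_vec n i j p k x T, l := kernel_vec n i j p l y T)) = 0"
proof (rule tangent_closureD[OF T])
  show "form_fun n (1 + (\<Sum>m<n. if m = k \<or> m = l then 2 else 0))
      (\<lambda>T. ev n T (\<phi>(k := kernel_vec n i j p k x T, l := kernel_vec n i j p l y T)))"
    by (rule form_fun_ev) (use kl(7) in \<open>auto intro: form_fun_kernel_vec form_fun.const cong: if_cong\<close>)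
  show "ev n (tangent_tensor n v w) (\<phi>(k := kernel_vec n i j p k x (tangent_tensor n v w),
      l := kernel_vec n i j p l y (tangent_tensor n v w))) = 0" for v w
    using kl by (intro ev_tangent_tensor_eq_0[of k _ l]) (auto simp: dot_kernel_vec_tangent_tensor ij)
qed

section \<open>Recovering \<open>v\<close> when a contracted determinant is nonzero\<close>

context
  fixes n i j :: nat and p :: "nat \<Rightarrow> complex \<times> complex"
  assumes ij: "i < n" "j < n" "i \<noteq> j"
begin

abbreviation kernel_contraction :: "nat \<Rightarrow> complex \<times> complex \<Rightarrow> complex \<times> complex \<Rightarrow> complex \<times> complex \<Rightarrow> tensor \<Rightarrow> complex" where
  "kernel_contraction k x a b T \<equiv> ev n T (p(k := kernel_vec n i j p k x T, i := a, j := b))"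

lemma form_fun_kernel_contraction:
  assumes k: "k \<noteq> i" "k \<noteq> j" "k < n"
  shows "form_fun n 3 (kernel_contraction k x a b)"
proof -
  have "form_fun n (1 + (\<Sum>m<n. if m = k then 2 else 0)) (kernel_contraction k x a b)"
    by (rule form_fun_ev) (use k in \<open>auto intro: form_fun_kernel_vec form_fun.const cong: if_cong\<close>)
  then show ?thesis using k by (simp add: numeral_3_eq_3)
qed

text \<open>One kernel vector in factor \<open>k\<close> kills the terms that contain
  \<open>w i\<close> or \<open>w j\<close>. The remaining matrix is a multiple of
  \<open>v i \<otimes> v j\<close> and so can reveal the two vectors that kernel vectors do not
  reach.\<close>

lemma kernel_contraction_tangent_tensor:
  assumes k: "k \<noteq> i" "k \<noteq> j" "k < n"
  obtains R where "\<And>a b. kernel_contraction k x a b (tangent_tensor n v w) = dot a (v i) * dot b (v j) * R"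
proof -
  let ?\<phi> = "p(k := kernel_vec n i j p k x (tangent_tensor n v w))"
  obtain R where R: "\<And>a b. ev n (tangent_tensor n v w) (?\<phi>(i := a, j := b)) =
    dot a (v i) * dot b (v j) * R +
    (dot a (w i) * dot b (v j) + dot a (v i) * dot b (w j)) * (\<Prod>m\<in>{..<n} - {i, j}. dot (?\<phi> m) (v m))"
    using ev_tangent_tensor_upd2[OF ij] by blast
  have *: "(\<Prod>m\<in>{..<n} - {i, j}. dot (?\<phi> m) (v m)) = 0"
    by (rule prod_zero) (use k dot_kernel_vec_tangent_tensor[OF ij] in auto)
  show ?thesis by (rule that[of R]) (simp only: R * mult_zero_right add_0_right)
qed

text \<open>On tangent tensors these matrices are multiples of one matrix of rank at most one. Their
  proportionality and the bound on their rank are equations of degree 6 in \<open>T\<close>, hence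
  hold on the closure.\<close>

lemma closure_kernel_contraction:
  assumes T: "in_tangent_closure n T" and k: "k < n" "k \<noteq> i" "k \<noteq> j" and l: "l < n" "l \<noteq> i" "l \<noteq> j"
  shows "kernel_contraction k x a b T * kernel_contraction l y a' b' T =
      kernel_contraction k x a' b' T * kernel_contraction l y a b T" (is ?th1)
    and "kernel_contraction k x a b T * kernel_contraction k x a' b' T =
      kernel_contraction k x a b' T * kernel_contraction k x a' b T" (is ?th2)
proof -
  have "kernel_contraction k x a b T * kernel_contraction l y a' b' T -
      kernel_contraction k x a' b' T * kernel_contraction l y a b T = 0"
  proof (rule tangent_closureD[OF T])
    show "form_fun n (3 + 3) (\<lambda>T. kernel_contraction k x a b T * kernel_contraction l y a' b' T -
      kernel_contraction k x a' b' T * kernel_contraction l y a b T)"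
      using k l by (intro form_fun_diff form_fun.mult form_fun_kernel_contraction) auto
    fix v w
    obtain R where R: "\<And>a b. kernel_contraction k x a b (tangent_tensor n v w) = dot a (v i) * dot b (v j) * R"
      using kernel_contraction_tangent_tensor[of k] k by blast
    obtain R' where R': "\<And>a b. kernel_contraction l y a b (tangent_tensor n v w) = dot a (v i) * dot b (v j) * R'"
      using kernel_contraction_tangent_tensor[of l] l by blast
    show "kernel_contraction k x a b (tangent_tensor n v w) * kernel_contraction l y a' b' (tangent_tensor n v w) -
      kernel_contraction k x a' b' (tangent_tensor n v w) * kernel_contraction l y a b (tangent_tensor n v w) = 0"
      unfolding R R' by (simp add: mult_ac)
  qed
  then show ?th1 by simp
  have "kernel_contraction k x a b T * kernel_contraction k x a' b' T -
      kernel_contraction k x a b' T * kernel_contraction k x a' b T = 0"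
  proof (rule tangent_closureD[OF T])
    show "form_fun n (3 + 3) (\<lambda>T. kernel_contraction k x a b T * kernel_contraction k x a' b' T -
      kernel_contraction k x a b' T * kernel_contraction k x a' b T)"
      using k by (intro form_fun_diff form_fun.mult form_fun_kernel_contraction) auto
    fix v w
    obtain R where R: "\<And>a b. kernel_contraction k x a b (tangent_tensor n v w) = dot a (v i) * dot b (v j) * R"
      using kernel_contraction_tangent_tensor[of k] k by blast
    show "kernel_contraction k x a b (tangent_tensor n v w) * kernel_contraction k x a' b' (tangent_tensor n v w) -
      kernel_contraction k x a b' (tangent_tensor n v w) * kernel_contraction k x a' b (tangent_tensor n v w) = 0"
      unfolding R by (simp add: mult_ac)
  qed
  then show ?th2 by simp
qed

text \<open>The nonzero determinant yields the vectors of the factors other than \<open>i\<close>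
  and \<open>j\<close>. The vectors for \<open>i\<close> and \<open>j\<close> come from the
  contractions with one annihilated argument, or from the contracted matrix itself if all those
  vanish. The equations of the closure then give the hypotheses of
  \<open>tangent_tensorI\<close>.\<close>

lemma closure_nondegenerate:
  assumes "n \<ge> 1" and T: "in_tangent_closure n T" and nz: "mixed_disc n i j T p p \<noteq> 0"
  shows "\<exists>v w. (\<forall>k<n. v k \<noteq> (0, 0)) \<and> T = tangent_tensor n v w"
proof -
  let ?\<beta> = "mixed_disc n i j T p p"
  \<comment> \<open>The functional that takes \<open>x\<close> to
    \<open>mixed_disc n i j T (p(k := x)) p\<close>, in coordinates and scaled to take the value 1
    at \<open>p k\<close>.\<close>
  define u where "u k = (mixed_disc n i j T (p(k := (1, 0))) p / ?\<beta>, mixed_disc n i j T (p(k := (0, 1))) p / ?\<beta>)" for k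
  have u: "mixed_disc n i j T (p(k := x)) p = ?\<beta> * dot x (u k)" if "k < n" "k \<noteq> i" "k \<noteq> j" for k x
    using mixed_disc_upd_linear[OF that, of T p x p] nz by (simp add: u_def dot_def distrib_left)
  have pu: "dot (p k) (u k) = 1" if "k < n" "k \<noteq> i" "k \<noteq> j" for k
    using u[OF that, of "p k"] nz by simp
  \<comment> \<open>On vectors annihilated by \<open>u k\<close> the kernel vector is a nonzero
    multiple of its argument, so the equations stated for kernel vectors apply to every such
    vector.\<close>
  have kv: "kernel_vec n i j p k x T = vcomb ?\<beta> x 0 x" if "k < n" "k \<noteq> i" "k \<noteq> j" "dot x (u k) = 0" for k x
    using u[OF that(1-3), of x] that(4) by (simp add: kernel_vec_def vcomb_def)
  have ann: "ev n T \<psi> = 0"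
    if "k < n" "k \<noteq> i" "k \<noteq> j" "l < n" "l \<noteq> i" "l \<noteq> j" "k \<noteq> l" "dot (\<psi> k) (u k) = 0" "dot (\<psi> l) (u l) = 0" for k l \<psi>
  proof -
    have "0 = ev n T (\<psi>(k := vcomb ?\<beta> (\<psi> k) 0 (\<psi> k), l := vcomb ?\<beta> (\<psi> l) 0 (\<psi> l)))"
      using closure_kernel_vec2[OF T ij that(1-7), of \<psi> p "\<psi> k" "\<psi> l"] that by (simp add: kv)
    also have "\<dots> = ?\<beta> * ev n T (\<psi>(k := vcomb ?\<beta> (\<psi> k) 0 (\<psi> k)))"
      using that by (simp add: ev_upd_linear fun_upd_idem)
    also have "\<dots> = ?\<beta> * (?\<beta> * ev n T \<psi>)"
      using that by (simp add: ev_upd_linear)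
    finally show ?thesis using nz by simp
  qed
  define N where "N k y a b = ev n T (p(k := y, i := a, j := b))" for k y a b
  define M where "M a b = ev n T (p(i := a, j := b))" for a b
  have kc: "kernel_contraction k y a b T = ?\<beta> * N k y a b" if "k < n" "k \<noteq> i" "k \<noteq> j" "dot y (u k) = 0" for k y a b
  proof -
    have "kernel_contraction k y a b T = ev n T (p(i := a, j := b, k := vcomb ?\<beta> y 0 y))"
      using that by (simp add: kv fun_upd_twist[of k])
    also have "\<dots> = ?\<beta> * N k y a b"
      using that by (simp add: ev_upd_linear N_def fun_upd_twist[of k])
    finally show ?thesis .
  qed
  have N1: "N k y a b * N l z a' b' = N k y a' b' * N l z a b"
    if "k < n" "k \<noteq> i" "k \<noteq> j" "dot y (u k) = 0" "l < n" "l \<noteq> i" "l \<noteq> j" "dot z (u l) = 0" for k y l z a b a' b'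
    using closure_kernel_contraction(1)[OF T that(1-3) that(5-7), of y a b z a' b'] nz
    by (simp add: kc that)
  have N2: "N k y a b * N k y a' b' = N k y a b' * N k y a' b"
    if "k < n" "k \<noteq> i" "k \<noteq> j" "dot y (u k) = 0" for k y a b a' b'
    using closure_kernel_contraction(2)[OF T that(1-3) that(1-3), of y a b a' b'] nz
    by (simp add: kc that)
  have NM: "N k y a b * M a' b' + N k y a' b' * M a b - N k y a b' * M a' b - N k y a' b * M a b' = 0"
    if "k < n" "k \<noteq> i" "k \<noteq> j" "dot y (u k) = 0" for k y a b a' b'
    using mixed_disc_vectors[OF ij, of T "p(k := y)" a b p a' b'] u[OF that(1-3), of y] that(4)
    by (simp add: N_def M_def)
  obtain vi vj where vij: "vi \<noteq> (0, 0)" "vj \<noteq> (0, 0)"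
    and M0: "\<And>a b. dot a vi = 0 \<Longrightarrow> dot b vj = 0 \<Longrightarrow> M a b = 0"
    and N0: "\<And>k y a b. k < n \<Longrightarrow> k \<noteq> i \<Longrightarrow> k \<noteq> j \<Longrightarrow> dot y (u k) = 0 \<Longrightarrow> dot a vi = 0 \<or> dot b vj = 0 \<Longrightarrow> N k y a b = 0"
  proof (cases "\<exists>k y a b. k < n \<and> k \<noteq> i \<and> k \<noteq> j \<and> dot y (u k) = 0 \<and> N k y a b \<noteq> 0")
    case True
    then obtain k y a0 b0 where k: "k < n" "k \<noteq> i" "k \<noteq> j" "dot y (u k) = 0" and N0: "N k y a0 b0 \<noteq> 0" by blast
    \<comment> \<open>A nonzero matrix of rank one is determined up to scale by the column and the
      row through a nonzero entry.\<close>
    define vi where "vi = (N k y (1, 0) b0, N k y (0, 1) b0)"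
    define vj where "vj = (N k y a0 (1, 0), N k y a0 (0, 1))"
    have vi: "dot a vi = N k y a b0" for a
      using ev_upd_basis[OF ij(1), of T "p(k := y, j := b0)" a] ij(3)
      by (simp add: N_def vi_def dot_def fun_upd_twist[of i])
    have vj: "dot b vj = N k y a0 b" for b
      using ev_upd_basis[OF ij(2), of T "p(k := y, i := a0)" b]
      by (simp add: N_def vj_def dot_def)
    have N00: "N k y a b = 0" if "dot a vi = 0 \<or> dot b vj = 0" for a b
      using N2[OF k, of a b a0 b0] N0 that vi vj by auto
    have "vi \<noteq> (0, 0)" "vj \<noteq> (0, 0)"
      using vi[of a0] vj[of b0] N0 by (auto simp: dot_def)
    \<comment> \<open>In the polarised determinant of \<open>N\<close> and \<open>M\<close> every
      other product contains an entry of \<open>N\<close> that vanishes, which leaves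
      \<open>N k y a0 b0 * M a b = 0\<close>.\<close>
    moreover have "M a b = 0" if "dot a vi = 0" "dot b vj = 0" for a b
      using NM[OF k, of a b a0 b0] N00[of a] N00[of _ b] that N0 by simp
    moreover have "N l z a b = 0" if "l < n" "l \<noteq> i" "l \<noteq> j" "dot z (u l) = 0" "dot a vi = 0 \<or> dot b vj = 0" for l z a b
      using N1[OF k that(1-4), of a0 b0 a b] N00[OF that(5)] N0 by simp
    ultimately show ?thesis by (rule that)
  next
    case False
    \<comment> \<open>Only the condition on \<open>M\<close> remains, and one of the two vectors is
      free. With \<open>(1, 0)\<close> for factor \<open>i\<close>, the other must be the second row
      of \<open>M\<close>; it is nonzero because the determinant of \<open>M\<close> is.\<close>
    define vj where "vj = (M (0, 1) (1, 0), M (0, 1) (0, 1))"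
    have M: "M a b = fst a * M (1, 0) b + snd a * M (0, 1) b" for a b
      using ev_upd_basis[OF ij(1), of T "p(j := b)" a] ij(3) by (simp add: M_def fun_upd_twist[of i])
    have vj: "dot b vj = M (0, 1) b" for b
      using ev_upd_basis[OF ij(2), of T "p(i := (0, 1))" b] by (simp add: M_def vj_def dot_def)
    have "vj \<noteq> (0, 0)" using nz by (auto simp: vj_def mixed_disc_def M_def)
    moreover have "M a b = 0" if "dot a (1, 0) = 0" "dot b vj = 0" for a b
      using that M[of a b] vj by (simp add: dot_def)
    moreover have "N k y a b = 0" if "k < n" "k \<noteq> i" "k \<noteq> j" "dot y (u k) = 0" for k y a b
      using False that by blast
    ultimately show ?thesis by (intro that[of "(1, 0)" vj]) auto
  qed
  obtain pi pj where pij: "dot pi vi = 1" "dot pj vj = 1"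
    using exists_dot_eq_1 vij by metis
  define v where "v = u(i := vi, j := vj)"
  define q where "q = p(i := pi, j := pj)"
  have qv: "dot (q k) (v k) = 1" if "k < n" for k
    using pu[OF that] pij ij(3) by (simp add: q_def v_def)
  have red: "ev n T \<psi> = 0" if kl: "k < n" "l < n" "k \<noteq> l" and \<psi>: "\<And>m. m < n \<Longrightarrow> \<psi> m = q m \<or> dot (\<psi> m) (v m) = 0"
    and ak: "dot (\<psi> k) (v k) = 0" and al: "dot (\<psi> l) (v l) = 0" for k l \<psi>
  proof -
    have vi: "v i = vi" "v j = vj" and vo: "\<And>m. m \<noteq> i \<Longrightarrow> m \<noteq> j \<Longrightarrow> v m = u m"
      using ij(3) by (simp_all add: v_def)
    let ?O = "{m. m < n \<and> m \<noteq> i \<and> m \<noteq> j \<and> dot (\<psi> m) (u m) = 0}"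
    \<comment> \<open>The case split counts the annihilated factors other than \<open>i\<close> and
      \<open>j\<close>: at least two are handled by \<open>ann\<close>, none by \<open>M0\<close>,
      exactly one by \<open>N0\<close>.\<close>
    consider "\<exists>k\<in>?O. \<exists>l\<in>?O. k \<noteq> l" | "?O = {}" | m where "?O = {m}" by blast
    then show ?thesis
    proof cases
      case 1
      then show ?thesis using ann by blast
    next
      case 2
      then have O: "m = i \<or> m = j" if "m < n" "dot (\<psi> m) (v m) = 0" for m
        using 2 that vo[of m] by (cases "m = i \<or> m = j") auto
      then have "dot (\<psi> i) vi = 0" "dot (\<psi> j) vj = 0" using O[OF kl(1) ak] O[OF kl(2) al] kl(3) ak al vi by auto
      moreover have "ev n T \<psi> = M (\<psi> i) (\<psi> j)"
        unfolding M_def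
      proof (rule ev_cong)
        fix m assume "m < n"
        then show "\<psi> m = (p(i := \<psi> i, j := \<psi> j)) m"
          using O[of m] \<psi>[of m] by (auto simp: q_def)
      qed
      ultimately show ?thesis using M0 by simp
    next
      case 3
      then have m: "m < n" "m \<noteq> i" "m \<noteq> j" "dot (\<psi> m) (u m) = 0"
        and mu: "\<And>k. k < n \<Longrightarrow> k \<noteq> i \<Longrightarrow> k \<noteq> j \<Longrightarrow> dot (\<psi> k) (u k) = 0 \<Longrightarrow> k = m" by auto
      have O: "m' = i \<or> m' = j \<or> m' = m" if "m' < n" "dot (\<psi> m') (v m') = 0" for m'
        using that vo[of m'] mu[of m'] by (cases "m' = i \<or> m' = j") auto
      have "dot (\<psi> i) vi = 0 \<or> dot (\<psi> j) vj = 0" using O[OF kl(1) ak] O[OF kl(2) al] kl(3) ak al vi by auto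
      moreover have "ev n T \<psi> = N m (\<psi> m) (\<psi> i) (\<psi> j)"
        unfolding N_def
      proof (rule ev_cong)
        fix k assume "k < n"
        then show "\<psi> k = (p(m := \<psi> m, i := \<psi> i, j := \<psi> j)) k"
          using O[of k] \<psi>[of k] by (auto simp: q_def)
      qed
      ultimately show ?thesis using N0[OF m] by simp
    qed
  qed
  have "\<exists>w. T = tangent_tensor n v w"
  proof (rule tangent_tensorI[of n T q])
    show "n \<ge> 1" "T \<in> tensor_space n" using assms by (simp_all add: in_tangent_closure_def)
    show "dot (q k) (v k) = 1" if "k < n" for k using qv[OF that] .
    show "ev n T \<psi> = 0" if "k < n" "l < n" "k \<noteq> l" "dot (\<psi> k) (v k) = 0" "dot (\<psi> l) (v l) = 0" for \<psi> k l
      by (rule annihilation_reduction[OF qv red[OF that(1-3)] that(4,5)])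
  qed
  moreover have "v k \<noteq> (0, 0)" if "k < n" for k
    using qv[OF that] by (auto simp: dot_def)
  ultimately show ?thesis by blast
qed

end

section \<open>The degenerate case: all contracted determinants vanish\<close>

lemma proportional_trans:
  fixes f g h :: "'a \<Rightarrow> complex"
  assumes "\<And>x y. f x * g y = f y * g x" "\<And>x y. g x * h y = g y * h x" "g z \<noteq> 0"
  shows "f x * h y = f y * h x"
proof -
  have "f x = f z * g x / g z" "f y = f z * g y / g z"
    using assms(1)[of x z] assms(1)[of y z] assms(3) by (simp_all add: field_simps)
  then show ?thesis using assms(2)[of x y] by (simp add: field_simps)
qed

text \<open>The components of \<open>\<phi>\<close> are changed into those of \<open>\<psi>\<close> one at a time; proportionality is transitive
  because for all but two scalars \<open>s\<close> the component \<open>\<psi>\<^sub>l + s \<phi>\<^sub>l\<close> makes both intermediate functionals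
  nonzero.\<close>

lemma proportional_of_adjacent:
  assumes i: "i < n"
    and adj: "\<And>\<phi> j z x y. j < n \<Longrightarrow> j \<noteq> i \<Longrightarrow>
      ev n T (\<phi>(i := x)) * ev n T (\<phi>(j := z, i := y)) = ev n T (\<phi>(i := y)) * ev n T (\<phi>(j := z, i := x))"
  shows "ev n T (\<phi>(i := x)) * ev n T (\<psi>(i := y)) = ev n T (\<phi>(i := y)) * ev n T (\<psi>(i := x))"
proof -
  have "ev n T (\<phi>(i := x)) * ev n T (\<psi>(i := y)) = ev n T (\<phi>(i := y)) * ev n T (\<psi>(i := x))"
    if "finite S" "\<And>k. k < n \<Longrightarrow> k \<notin> S \<Longrightarrow> k \<noteq> i \<Longrightarrow> \<phi> k = \<psi> k" for S \<phi> \<psi> x y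
    using that
  proof (induction S arbitrary: \<phi> \<psi> x y rule: finite_induct)
    case empty
    then have *: "ev n T (\<phi>(i := a)) = ev n T (\<psi>(i := a))" for a by (intro ev_cong) auto
    show ?case unfolding * by (rule mult.commute)
  next
    case (insert l S)
    show ?case
    proof (cases "l < n \<and> l \<noteq> i \<and> (\<exists>z. ev n T (\<phi>(i := z)) \<noteq> 0) \<and> (\<exists>z. ev n T (\<psi>(i := z)) \<noteq> 0)")
      case False
      then consider "l \<ge> n \<or> l = i" | "\<forall>z. ev n T (\<phi>(i := z)) = 0" | "\<forall>z. ev n T (\<psi>(i := z)) = 0"
        by force
      then show ?thesis
      proof cases
        case 1
        then show ?thesis by (intro insert.IH insert.prems) auto
      qed (simp_all only: mult_zero_left mult_zero_right)
    next
      case True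
      then obtain a b where l: "l < n" "l \<noteq> i" and a: "ev n T (\<phi>(i := a)) \<noteq> 0" and b: "ev n T (\<psi>(i := b)) \<noteq> 0"
        by blast
      \<comment> \<open>The values of \<open>s\<close> at which one of the two intermediate
        evaluations would vanish. If the denominator in \<open>?s2\<close> is 0, the quotient is 0
        by convention; the evaluation is then independent of \<open>s\<close> and nonzero
        anyway.\<close>
      let ?s1 = "- ev n T (\<phi>(l := \<psi> l, i := a)) / ev n T (\<phi>(i := a))"
      let ?s2 = "- ev n T (\<psi>(i := b)) / ev n T (\<psi>(l := \<phi> l, i := b))"
      obtain s where s: "s \<notin> {?s1, ?s2}"
        using ex_new_if_finite[OF infinite_UNIV_char_0, of "{?s1, ?s2}"] by blast
      define u where "u = vcomb 1 (\<psi> l) s (\<phi> l)"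
      have "ev n T (\<phi>(l := u, i := a)) = ev n T (\<phi>(l := \<psi> l, i := a)) + s * ev n T (\<phi>(i := a))"
        using ev_upd_linear[OF l(1), of T "\<phi>(i := a)" 1 "\<psi> l" s "\<phi> l"] l
        by (simp add: u_def fun_upd_twist[of l] fun_upd_idem)
      then have a': "ev n T (\<phi>(l := u, i := a)) \<noteq> 0"
        using s a by (auto simp: field_simps add_eq_0_iff)
      have "ev n T (\<psi>(l := u, i := b)) = ev n T (\<psi>(i := b)) + s * ev n T (\<psi>(l := \<phi> l, i := b))"
        using ev_upd_linear[OF l(1), of T "\<psi>(i := b)" 1 "\<psi> l" s "\<phi> l"] l
        by (simp add: u_def fun_upd_twist[of l] fun_upd_idem)
      then have b': "ev n T (\<psi>(l := u, i := b)) \<noteq> 0"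
        using s b by (cases "ev n T (\<psi>(l := \<phi> l, i := b)) = 0") (auto simp: field_simps add_eq_0_iff)
      have 1: "ev n T (\<phi>(i := x)) * ev n T (\<phi>(l := u, i := y)) = ev n T (\<phi>(i := y)) * ev n T (\<phi>(l := u, i := x))" for x y
        by (rule adj[OF l])
      have 2: "ev n T (\<phi>(l := u, i := x)) * ev n T (\<psi>(l := u, i := y)) = ev n T (\<phi>(l := u, i := y)) * ev n T (\<psi>(l := u, i := x))" for x y
        by (rule insert.IH) (use insert.prems in auto)
      have 3: "ev n T (\<psi>(l := u, i := x)) * ev n T (\<psi>(i := y)) = ev n T (\<psi>(l := u, i := y)) * ev n T (\<psi>(i := x))" for x y
        using adj[OF l, of \<psi> y u x] by (simp add: mult.commute)
      have "ev n T (\<phi>(i := x)) * ev n T (\<psi>(l := u, i := y)) = ev n T (\<phi>(i := y)) * ev n T (\<psi>(l := u, i := x))" for x y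
        by (rule proportional_trans[where g = "\<lambda>x. ev n T (\<phi>(l := u, i := x))", OF 1 2 a'])
      then show ?thesis
        by (rule proportional_trans[where g = "\<lambda>x. ev n T (\<psi>(l := u, i := x))", OF _ 3 b'])
    qed
  qed
  from this[of "{..<n}"] show ?thesis by simp
qed

text \<open>In the degenerate case, for each factor \<open>i\<close> all functionals obtained by
  fixing the other arguments are proportional. A nonzero value \<open>ev n T p\<close> then provides
  one vector per factor, and \<open>T\<close> vanishes as soon as one argument is annihilated by its
  vector.\<close>

lemma closure_is_tangent_tensor:
  assumes "n \<ge> 1" and T: "in_tangent_closure n T" and "T \<noteq> (\<lambda>_. 0)"
  shows "\<exists>v w. (\<forall>k<n. v k \<noteq> (0, 0)) \<and> T = tangent_tensor n v w"
proof (cases "\<exists>i j p. i < n \<and> j < n \<and> i \<noteq> j \<and> mixed_disc n i j T p p \<noteq> 0")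
  case True
  then show ?thesis using closure_nondegenerate assms(1) T by blast
next
  case False
  have Tn: "T \<in> tensor_space n" using T by (simp add: in_tangent_closure_def)
  have proportional: "ev n T (\<phi>(i := x)) * ev n T (\<psi>(i := y)) = ev n T (\<phi>(i := y)) * ev n T (\<psi>(i := x))"
    if i: "i < n" for i \<phi> \<psi> x y
  proof (rule proportional_of_adjacent[OF i])
    fix \<phi> :: "nat \<Rightarrow> complex \<times> complex" and j z x y assume j: "j < n" "j \<noteq> i"
    have "mixed_disc n i j T \<phi> \<phi> = 0" using False i j by blast
    \<comment> \<open>With equal families the polarised determinant is twice an ordinary
      \<open>2 x 2\<close> determinant, here for arbitrary arguments in the factors \<open>i\<close>
      and \<open>j\<close>.\<close>
    then have "2 * (ev n T (\<phi>(i := x, j := \<phi> j)) * ev n T (\<phi>(i := y, j := z)) -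
        ev n T (\<phi>(i := y, j := \<phi> j)) * ev n T (\<phi>(i := x, j := z))) = 0"
      using mixed_disc_vectors[OF i j(1), of T \<phi> x "\<phi> j" \<phi> y z] j by (simp add: algebra_simps)
    then show "ev n T (\<phi>(i := x)) * ev n T (\<phi>(j := z, i := y)) = ev n T (\<phi>(i := y)) * ev n T (\<phi>(j := z, i := x))"
      using j by (simp add: fun_upd_twist[of j] fun_upd_idem)
  qed
  obtain p where p: "ev n T p \<noteq> 0"
  proof (rule ccontr)
    assume "\<not> thesis"
    then have "ev n T p = 0" for p using that by blast
    then have "T = (\<lambda>_. 0)"
      by (intro tensor_eqI[OF Tn]) (simp_all add: tensor_space_def ev_def)
    then show False using assms(3) by simp
  qed
  define v where "v k = (ev n T (p(k := (1, 0))) / ev n T p, ev n T (p(k := (0, 1))) / ev n T p)" for k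
  have v: "ev n T (p(k := x)) = dot x (v k) * ev n T p" if "k < n" for k x
    using ev_upd_basis[OF that, of T p x] p by (simp add: v_def dot_def field_simps)
  have pv: "dot (p k) (v k) = 1" if "k < n" for k
    using v[OF that, of "p k"] p by simp
  have "\<exists>w. T = tangent_tensor n v w"
  proof (rule tangent_tensorI[OF assms(1) Tn pv])
    fix \<psi> k l assume "k < n" "dot (\<psi> k) (v k) = 0"
    then show "ev n T \<psi> = 0"
      using proportional[of k \<psi> "\<psi> k" p "p k"] v[of k "\<psi> k"] p by simp
  qed
  moreover have "v k \<noteq> (0, 0)" if "k < n" for k
    using pv[OF that] by (auto simp: dot_def)
  ultimately show ?thesis by blast
qed

section \<open>Principal minors of diagonal plus rank-one matrices\<close>

text \<open>Composition with the transposition of \<open>a\<close> and \<open>b\<close> permutes the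
  summands and reverses every sign, so the sum equals its own negative.\<close>

lemma sum_signof_permutes:
  assumes "finite S" "a \<in> S" "b \<in> S" "a \<noteq> b"
  shows "(\<Sum>p | p permutes S. signof p) = (0 :: 'a :: {idom, ring_char_0})"
proof -
  have "(\<Sum>p | p permutes S. signof p) = (\<Sum>p | p permutes S. signof (transpose a b \<circ> p) :: 'a)"
    by (rule setum_permutations_compose_left) (use assms in \<open>simp add: permutes_swap_id\<close>)
  also have "\<dots> = (\<Sum>p | p permutes S. - signof p)"
  proof (rule sum.cong[OF refl])
    fix p assume "p \<in> {p. p permutes S}"
    then have "sign (transpose a b \<circ> p) = - sign p"
      using assms permutes_imp_permutation[of S p]
      by (subst sign_compose) (auto simp: permutation_swap_id sign_swap_id)
    then show "signof (transpose a b \<circ> p) = (- signof p :: 'a)" by simp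
  qed
  finally show ?thesis by (simp add: sum_negf)
qed

text \<open>In the Leibniz formula each product is expanded over the set \<open>S\<close> of rows
  that contribute \<open>x i * x (p i)\<close>. The other rows force \<open>p\<close> to fix their
  index, so \<open>p\<close> permutes \<open>S\<close> and the term carries the sum of signs over
  such \<open>p\<close>. That sum vanishes unless \<open>S\<close> has at most one element.\<close>

lemma det_diag_plus_rank1:
  fixes d x :: "nat \<Rightarrow> 'a :: {idom, ring_char_0}"
  shows "det (mat m m (\<lambda>(i, j). (if i = j then d i else 0) + x i * x j)) =
    (\<Prod>i<m. d i) + (\<Sum>i<m. (x i)\<^sup>2 * (\<Prod>k\<in>{..<m} - {i}. d k))"
proof -
  let ?U = "{0..<m}"
  let ?M = "mat m m (\<lambda>(i, j). (if i = j then d i else 0) + x i * x j)"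
  let ?t = "\<lambda>S. (\<Prod>i\<in>S. x i)\<^sup>2 * (\<Prod>i\<in>?U - S. d i) * (\<Sum>p | p permutes S. signof p)"
  have "det ?M = (\<Sum>p | p permutes ?U. signof p * (\<Prod>i\<in>?U. ?M $$ (i, p i)))"
    by (rule det_def') simp
  also have "\<dots> = (\<Sum>p | p permutes ?U. \<Sum>S\<in>Pow ?U. signof p *
      ((\<Prod>i\<in>S. x i * x (p i)) * (\<Prod>i\<in>?U - S. if i = p i then d i else 0)))"
  proof (rule sum.cong[OF refl])
    fix p assume "p \<in> {p. p permutes ?U}"
    then have "p i < m" if "i < m" for i
      using permutes_in_image[of p ?U i] that by simp
    then have "(\<Prod>i\<in>?U. ?M $$ (i, p i)) = (\<Prod>i\<in>?U. x i * x (p i) + (if i = p i then d i else 0))"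
      by (intro prod.cong) auto
    also have "\<dots> = (\<Sum>S\<in>Pow ?U. (\<Prod>i\<in>S. x i * x (p i)) * (\<Prod>i\<in>?U - S. if i = p i then d i else 0))"
      by (rule prod_add) simp
    finally show "signof p * (\<Prod>i\<in>?U. ?M $$ (i, p i)) = (\<Sum>S\<in>Pow ?U. signof p *
      ((\<Prod>i\<in>S. x i * x (p i)) * (\<Prod>i\<in>?U - S. if i = p i then d i else 0)))"
      by (simp add: sum_distrib_left)
  qed
  also have "\<dots> = (\<Sum>S\<in>Pow ?U. \<Sum>p | p permutes ?U. signof p *
      ((\<Prod>i\<in>S. x i * x (p i)) * (\<Prod>i\<in>?U - S. if i = p i then d i else 0)))"
    by (rule sum.swap)
  also have "\<dots> = (\<Sum>S\<in>Pow ?U. ?t S)"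
  proof (rule sum.cong[OF refl])
    fix S assume "S \<in> Pow ?U"
    then have S: "S \<subseteq> ?U" by simp
    have "(\<Sum>p | p permutes ?U. signof p *
      ((\<Prod>i\<in>S. x i * x (p i)) * (\<Prod>i\<in>?U - S. if i = p i then d i else 0))) =
      (\<Sum>p | p permutes S. signof p *
      ((\<Prod>i\<in>S. x i * x (p i)) * (\<Prod>i\<in>?U - S. if i = p i then d i else 0)))"
    proof (rule sum.mono_neutral_right)
      show "finite {p. p permutes ?U}" by (simp add: finite_permutations)
      show "{p. p permutes S} \<subseteq> {p. p permutes ?U}" using S permutes_subset by blast
      show "\<forall>p\<in>{p. p permutes ?U} - {p. p permutes S}. signof p *
        ((\<Prod>i\<in>S. x i * x (p i)) * (\<Prod>i\<in>?U - S. if i = p i then d i else 0)) = 0"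
      proof
        fix p assume p: "p \<in> {p. p permutes ?U} - {p. p permutes S}"
        then obtain i where "i \<in> ?U - S" "p i \<noteq> i"
          using permutes_superset[of p ?U S] by blast
        then have "(\<Prod>i\<in>?U - S. if i = p i then d i else 0) = 0"
          by (intro prod_zero) (simp, metis)
        then show "signof p *
          ((\<Prod>i\<in>S. x i * x (p i)) * (\<Prod>i\<in>?U - S. if i = p i then d i else 0)) = 0" by simp
      qed
    qed
    also have "\<dots> = (\<Sum>p | p permutes S. signof p * ((\<Prod>i\<in>S. x i)\<^sup>2 * (\<Prod>i\<in>?U - S. d i)))"
    proof (rule sum.cong[OF refl])
      fix p assume "p \<in> {p. p permutes S}"
      then have p: "p permutes S" by simp
      have "(\<Prod>i\<in>S. x (p i)) = (\<Prod>i\<in>S. x i)"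
        using prod.permute[OF p, of x] by (simp add: comp_def)
      moreover have "(\<Prod>i\<in>?U - S. if i = p i then d i else 0) = (\<Prod>i\<in>?U - S. d i)"
        using permutes_not_in[OF p] by (intro prod.cong) auto
      ultimately show "signof p * ((\<Prod>i\<in>S. x i * x (p i)) * (\<Prod>i\<in>?U - S. if i = p i then d i else 0)) =
        signof p * ((\<Prod>i\<in>S. x i)\<^sup>2 * (\<Prod>i\<in>?U - S. d i))"
        by (simp add: prod.distrib power2_eq_square)
    qed
    finally show "(\<Sum>p | p permutes ?U. signof p *
      ((\<Prod>i\<in>S. x i * x (p i)) * (\<Prod>i\<in>?U - S. if i = p i then d i else 0))) = ?t S"
      by (simp add: sum_distrib_right[symmetric] mult.commute)
  qed
  also have "\<dots> = (\<Sum>S\<in>insert {} ((\<lambda>i. {i}) ` ?U). ?t S)"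
  proof (rule sum.mono_neutral_right)
    show "\<forall>S\<in>Pow ?U - insert {} ((\<lambda>i. {i}) ` ?U). ?t S = 0"
    proof
      fix S assume S: "S \<in> Pow ?U - insert {} ((\<lambda>i. {i}) ` ?U)"
      then obtain a where a: "a \<in> S" by blast
      moreover have "S \<noteq> {a}" using S a by auto
      ultimately obtain b where "b \<in> S" "a \<noteq> b" by blast
      moreover have "finite S" using S finite_subset by auto
      ultimately have "(\<Sum>p | p permutes S. signof p) = (0 :: 'a)"
        using a by (intro sum_signof_permutes[of S a b])
      then show "?t S = 0" by simp
    qed
  qed auto
  also have "\<dots> = ?t {} + (\<Sum>S\<in>(\<lambda>i. {i}) ` ?U. ?t S)"
    by (subst sum.insert) auto
  also have "(\<Sum>S\<in>(\<lambda>i. {i}) ` ?U. ?t S) = (\<Sum>i\<in>?U. ?t {i})"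
    by (subst sum.reindex) (auto simp: inj_on_def)
  finally show ?thesis by (simp add: lessThan_atLeast0 sign_id)
qed

lemma bij_betw_pick:
  assumes "finite I"
  shows "bij_betw (pick I) {..<card I} I"
proof (rule bij_betw_imageI)
  show inj: "inj_on (pick I) {..<card I}"
  proof (rule inj_onI)
    fix i j assume "i \<in> {..<card I}" "j \<in> {..<card I}" "pick I i = pick I j"
    then show "i = j" by (metis card_pick_le lessThan_iff)
  qed
  have "pick I ` {..<card I} \<subseteq> I" by (auto intro: pick_in_set_le)
  moreover have "card (pick I ` {..<card I}) = card I" using inj by (simp add: card_image)
  ultimately show "pick I ` {..<card I} = I" using assms by (simp add: card_subset_eq)
qed

lemma submatrix_mat:
  assumes "A \<in> carrier_mat n m" "I \<subseteq> {..<n}" "J \<subseteq> {..<m}"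
  shows "submatrix A I J = mat (card I) (card J) (\<lambda>(i, j). A $$ (pick I i, pick J j))"
proof -
  have "{i. i < dim_row A \<and> i \<in> I} = I" "{i. i < dim_col A \<and> i \<in> J} = J" using assms by auto
  then show ?thesis by (simp add: submatrix_def)
qed

lemma minor_det_diag_plus_rank1:
  assumes A: "A \<in> carrier_mat n n" and I: "I \<subseteq> {..<n}"
    and u: "\<And>i j. i < n \<Longrightarrow> j < n \<Longrightarrow> A $$ (i, j) = (if i = j then d i else 0) + u i * u j"
  shows "minor_det A I I = (\<Prod>i\<in>I. d i) + (\<Sum>i\<in>I. (u i)\<^sup>2 * (\<Prod>k\<in>I - {i}. d k))"
proof -
  let ?m = "card I"
  have fin: "finite I" using I finite_subset by auto
  note bij = bij_betw_pick[OF fin]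
  have lt: "pick I i < n" if "i < ?m" for i using pick_in_set_le[OF that] I by auto
  have inj: "pick I i = pick I j \<longleftrightarrow> i = j" if "i < ?m" "j < ?m" for i j
    using bij that by (auto simp: bij_betw_def inj_on_def)
  have "submatrix A I I = mat ?m ?m (\<lambda>(i, j). (if i = j then d (pick I i) else 0) + u (pick I i) * u (pick I j))"
    unfolding submatrix_mat[OF A I I] by (rule eq_matI) (auto simp: u lt inj)
  then have "minor_det A I I = (\<Prod>i<?m. d (pick I i)) +
      (\<Sum>i<?m. (u (pick I i))\<^sup>2 * (\<Prod>k\<in>{..<?m} - {i}. d (pick I k)))"
    by (simp add: minor_det_def det_diag_plus_rank1)
  also have "(\<Prod>i<?m. d (pick I i)) = (\<Prod>i\<in>I. d i)"
    by (rule prod.reindex_bij_betw[OF bij])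
  also have "(\<Sum>i<?m. (u (pick I i))\<^sup>2 * (\<Prod>k\<in>{..<?m} - {i}. d (pick I k))) =
      (\<Sum>i<?m. (u (pick I i))\<^sup>2 * (\<Prod>k\<in>I - {pick I i}. d k))"
  proof (rule sum.cong[OF refl])
    fix i assume "i \<in> {..<?m}"
    then have "bij_betw (pick I) ({..<?m} - {i}) (I - {pick I i})"
      by (intro bij_betw_DiffI[OF bij]) (auto intro: pick_in_set_le)
    then show "(u (pick I i))\<^sup>2 * (\<Prod>k\<in>{..<?m} - {i}. d (pick I k)) =
        (u (pick I i))\<^sup>2 * (\<Prod>k\<in>I - {pick I i}. d k)"
      using prod.reindex_bij_betw by metis
  qed
  also have "\<dots> = (\<Sum>i\<in>I. (u i)\<^sup>2 * (\<Prod>k\<in>I - {i}. d k))"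
    by (rule sum.reindex_bij_betw[OF bij])
  finally show ?thesis .
qed

text \<open>Every factor outside \<open>I\<close> contributes one \<open>t\<close>. The zero in
  \<open>(0, (u i)\<^sup>2)\<close> removes the summands with \<open>i\<close> outside
  \<open>I\<close>, so the remaining ones match the rank-one part of the minor.\<close>

lemma principal_minor_tensor_diag_plus_rank1:
  assumes A: "A \<in> carrier_mat n n"
    and u: "\<And>i j. i < n \<Longrightarrow> j < n \<Longrightarrow> A $$ (i, j) = (if i = j then d i else 0) + u i * u j"
  shows "principal_minor_tensor n A t I = pure_tensor n (\<lambda>i. (t, d i)) I +
    tangent_tensor n (\<lambda>i. (t, d i)) (\<lambda>i. (0, (u i)\<^sup>2)) I"
proof (cases "I \<subseteq> {..<n}")
  case True
  have fin: "finite I" using True finite_subset by auto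
  have prd: "(\<Prod>i\<in>{..<n} - B. if i \<in> I then d i else t) = t ^ (n - card I) * (\<Prod>i\<in>I - B. d i)"
    if "B \<subseteq> I" for B
  proof -
    have "{..<n} - B = (I - B) \<union> ({..<n} - I)" using that True by auto
    then have "(\<Prod>i\<in>{..<n} - B. if i \<in> I then d i else t) =
        (\<Prod>i\<in>I - B. if i \<in> I then d i else t) * (\<Prod>i\<in>{..<n} - I. if i \<in> I then d i else t)"
      using fin by (simp add: prod.union_disjoint disjoint_iff)
    also have "\<dots> = (\<Prod>i\<in>I - B. d i) * (\<Prod>i\<in>{..<n} - I. t)"
      by (intro arg_cong2[where f = "(*)"] prod.cong) auto
    finally show ?thesis using True fin by (simp add: card_Diff_subset)
  qed
  have "pure_tensor n ((\<lambda>i. (t, d i))(k := (0, (u k)\<^sup>2))) I =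
      (if k \<in> I then t ^ (n - card I) * ((u k)\<^sup>2 * (\<Prod>i\<in>I - {k}. d i)) else 0)" if "k < n" for k
    using prd[of "{k}"] that True by (auto simp: pure_tensor_upd cong: if_cong)
  then have "tangent_tensor n (\<lambda>i. (t, d i)) (\<lambda>i. (0, (u i)\<^sup>2)) I =
      (\<Sum>k<n. if k \<in> I then t ^ (n - card I) * ((u k)\<^sup>2 * (\<Prod>i\<in>I - {k}. d i)) else 0)"
    by (simp add: tangent_tensor_def)
  also have "\<dots> = (\<Sum>k\<in>I. t ^ (n - card I) * ((u k)\<^sup>2 * (\<Prod>i\<in>I - {k}. d i)))"
    using True by (simp add: sum.inter_restrict[symmetric] Int_absorb1)
  finally have tt: "tangent_tensor n (\<lambda>i. (t, d i)) (\<lambda>i. (0, (u i)\<^sup>2)) I =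
    t ^ (n - card I) * (\<Sum>k\<in>I. (u k)\<^sup>2 * (\<Prod>i\<in>I - {k}. d i))"
    by (simp add: sum_distrib_left)
  have "pure_tensor n (\<lambda>i. (t, d i)) I = t ^ (n - card I) * (\<Prod>i\<in>I. d i)"
    using prd[of "{}"] True by (simp add: pure_tensor_def cong: if_cong)
  then show ?thesis
    using True minor_det_diag_plus_rank1[OF A True u]
    by (simp add: principal_minor_tensor_def tt distrib_left)
next
  case False
  then show ?thesis
    by (simp add: principal_minor_tensor_def pure_tensor_def tangent_tensor_def)
qed

text \<open>The pure tensor is itself a tangent direction: it is absorbed by adding \<open>a\<close>
  times \<open>v 0\<close> to the vector of factor 0.\<close>

lemma lincomb_pure_tangent_tensor:
  assumes "n \<ge> 1"
  shows "\<exists>w'. lincomb a (pure_tensor n v) b (tangent_tensor n v w) = tangent_tensor n v w'"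
proof
  let ?w = "\<lambda>i. vcomb (if i = 0 then a else 0) (v i) b (w i)"
  show "lincomb a (pure_tensor n v) b (tangent_tensor n v w) = tangent_tensor n v ?w"
  proof
    fix I
    have "tangent_tensor n v ?w I = (\<Sum>i<n. (if i = 0 then a else 0) * pure_tensor n v I + b * pure_tensor n (v(i := w i)) I)"
      unfolding tangent_tensor_def by (intro sum.cong) (auto simp: pure_tensor_upd_linear fun_upd_idem)
    also have "\<dots> = (\<Sum>i<n. if i = 0 then a else 0) * pure_tensor n v I + b * (\<Sum>i<n. pure_tensor n (v(i := w i)) I)"
      by (simp only: sum.distrib sum_distrib_left sum_distrib_right)
    also have "\<dots> = a * pure_tensor n v I + b * tangent_tensor n v w I"
      using assms by (simp add: tangent_tensor_def)
    finally show "lincomb a (pure_tensor n v) b (tangent_tensor n v w) I = tangent_tensor n v ?w I"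
      by (simp add: lincomb_def)
  qed
qed

lemma scale_tangent_tensor:
  assumes "n \<ge> 1"
  shows "\<exists>w'. (\<lambda>I. c * tangent_tensor n v w I) = tangent_tensor n v w'"
  using lincomb_pure_tangent_tensor[OF assms, of 0 v c w] by (simp add: lincomb_def)

lemma principal_minor_tensor_rank1_is_tangent:
  assumes "n \<ge> 1" "A \<in> carrier_mat n n"
    and u: "\<And>i j. i < n \<Longrightarrow> j < n \<Longrightarrow> i \<noteq> j \<Longrightarrow> A $$ (i, j) = u i * u j"
  shows "\<exists>v w. principal_minor_tensor n A t = tangent_tensor n v w"
proof -
  \<comment> \<open>The diagonal of \<open>A\<close> is unrestricted; \<open>?d\<close> absorbs its
    difference from the squares of the \<open>u i\<close>.\<close>
  let ?d = "\<lambda>i. A $$ (i, i) - u i * u i"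
  have "principal_minor_tensor n A t =
      lincomb 1 (pure_tensor n (\<lambda>i. (t, ?d i))) 1 (tangent_tensor n (\<lambda>i. (t, ?d i)) (\<lambda>i. (0, (u i)\<^sup>2)))"
    using principal_minor_tensor_diag_plus_rank1[OF assms(2), of ?d u t] u
    by (simp add: lincomb_def fun_eq_iff)
  then show ?thesis
    using lincomb_pure_tangent_tensor[OF assms(1), of 1 "\<lambda>i. (t, ?d i)" 1 "\<lambda>i. (0, (u i)\<^sup>2)"] by auto
qed

section \<open>Symmetric matrices of exclusive rank at most one\<close>

lemma minor_det_2:
  assumes A: "A \<in> carrier_mat n n" and I: "I \<subseteq> {..<n}" "card I = 2" and J: "J \<subseteq> {..<n}" "card J = 2"
  shows "minor_det A I J =
    A $$ (pick I 0, pick J 0) * A $$ (pick I 1, pick J 1) - A $$ (pick I 0, pick J 1) * A $$ (pick I 1, pick J 0)"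
  unfolding minor_det_def submatrix_mat[OF A I(1) J(1)] I(2) J(2)
  by (subst laplace_expansion_row[of _ 2 0]) (auto simp: numeral_2_eq_2 cofactor_def mat_delete_def det_single)

lemma pick_2:
  assumes "card I = 2"
  shows "I = {pick I 0, pick I 1}"
proof -
  have "finite I" using assms by (metis card.infinite zero_neq_numeral)
  then have "I = pick I ` {..<card I}" using bij_betw_pick[of I] by (simp add: bij_betw_def)
  then show ?thesis using assms by (simp add: numeral_2_eq_2 lessThan_Suc insert_commute)
qed

lemma E_rank_le_1D:
  assumes A: "A \<in> carrier_mat n n" and "E_rank A \<le> 1"
    and "i < n" "j < n" "k < n" "l < n" "distinct [i, j, k, l]"
  shows "A $$ (i, j) * A $$ (k, l) = A $$ (i, l) * A $$ (k, j)"
proof -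
  \<comment> \<open>A witness for \<open>LEAST\<close>: there are no index sets of size
    \<open>n + 1\<close>.\<close>
  have "E_minors_vanish A (n + 1)"
    unfolding E_minors_vanish_def
  proof (intro allI impI)
    fix I J assume "I \<subseteq> {..<dim_row A}" "card I = n + 1"
    then show "minor_det A I J = 0" using A card_mono[of "{..<n}" I] by auto
  qed
  then have "E_minors_vanish A (E_rank A + 1)"
    unfolding E_rank_def by (rule LeastI)
  \<comment> \<open>E-rank 0 is separate from E-rank 1: vanishing \<open>1 x 1\<close> exclusive
    minors mean that all off-diagonal entries are 0.\<close>
  then consider "E_minors_vanish A 1" | "E_minors_vanish A 2"
    using assms(2) by (cases "E_rank A") (auto simp: numeral_2_eq_2)
  then show ?thesis
  proof cases
    case 1
    have "A $$ (i, j) = 0" if "i < n" "j < n" "i \<noteq> j" for i j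
    proof -
      have "minor_det A {i} {j} = 0"
        using 1 A that unfolding E_minors_vanish_def by auto
      moreover have "pick {m} 0 = m" for m using pick_in_set_le[of 0 "{m}"] by simp
      ultimately show ?thesis
        using that A by (simp add: minor_det_def submatrix_mat[of A n n] det_single)
    qed
    then show ?thesis using assms by simp
  next
    case 2
    let ?I = "{i, k}" and ?J = "{j, l}"
    have IJ: "?I \<subseteq> {..<n}" "card ?I = 2" "?J \<subseteq> {..<n}" "card ?J = 2" "?I \<inter> ?J = {}" using assms by auto
    then have "minor_det A ?I ?J = 0" using 2 A unfolding E_minors_vanish_def by auto
    then have "A $$ (pick ?I 0, pick ?J 0) * A $$ (pick ?I 1, pick ?J 1) =
        A $$ (pick ?I 0, pick ?J 1) * A $$ (pick ?I 1, pick ?J 0)"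
      using minor_det_2[OF A IJ(1-4)] by simp
    \<comment> \<open>\<open>pick\<close> lists a set in increasing order, so \<open>i\<close> and
      \<open>k\<close>, or \<open>j\<close> and \<open>l\<close>, may appear swapped. The relation
      is invariant under either swap.\<close>
    moreover have "pick ?I 0 = i \<and> pick ?I 1 = k \<or> pick ?I 0 = k \<and> pick ?I 1 = i"
      using pick_2[OF IJ(2)] by (auto simp: doubleton_eq_iff)
    moreover have "pick ?J 0 = j \<and> pick ?J 1 = l \<or> pick ?J 0 = l \<and> pick ?J 1 = j"
      using pick_2[OF IJ(4)] by (auto simp: doubleton_eq_iff)
    ultimately show ?thesis by (auto simp: mult.commute)
  qed
qed

lemma E_rank_le_1I:
  assumes A: "A \<in> carrier_mat n n"
    and u: "\<And>i j. i < n \<Longrightarrow> j < n \<Longrightarrow> i \<noteq> j \<Longrightarrow> A $$ (i, j) = u i * u j"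
  shows "E_rank A \<le> 1"
proof -
  have "E_minors_vanish A (1 + 1)"
    unfolding E_minors_vanish_def
  proof (intro allI impI)
    fix I J assume "I \<subseteq> {..<dim_row A}" "J \<subseteq> {..<dim_col A}" "card I = 1 + 1" "card J = 1 + 1" "I \<inter> J = {}"
    then have IJ: "I \<subseteq> {..<n}" "card I = 2" "J \<subseteq> {..<n}" "card J = 2" "I \<inter> J = {}" using A by auto
    have "A $$ (i, j) = u i * u j" if "i \<in> I" "j \<in> J" for i j using u IJ that by blast
    moreover have "pick I 0 \<in> I" "pick I 1 \<in> I" "pick J 0 \<in> J" "pick J 1 \<in> J"
      using IJ by (auto intro!: pick_in_set_le simp del: pick.simps)
    ultimately show "minor_det A I J = 0" using minor_det_2[OF A IJ(1-4)] by simp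
  qed
  then show ?thesis unfolding E_rank_def by (rule Least_le)
qed

text \<open>The graph of nonzero off-diagonal entries either contains a triangle, which determines \<open>u\<close>, or
  is a star: two disjoint edges span a complete graph on four vertices.\<close>

lemma off_diagonal_rank1_cases:
  fixes a :: "nat \<Rightarrow> nat \<Rightarrow> complex"
  assumes sym: "\<And>i j. i < n \<Longrightarrow> j < n \<Longrightarrow> a i j = a j i"
    and rel: "\<And>i j k l. i < n \<Longrightarrow> j < n \<Longrightarrow> k < n \<Longrightarrow> l < n \<Longrightarrow> distinct [i, j, k, l] \<Longrightarrow>
      a i j * a k l = a i l * a k j"
  obtains (rank1) u where "\<And>i j. i < n \<Longrightarrow> j < n \<Longrightarrow> i \<noteq> j \<Longrightarrow> a i j = u i * u j"
  | (star) c where "\<And>i j. i < n \<Longrightarrow> j < n \<Longrightarrow> i \<noteq> j \<Longrightarrow> i \<noteq> c \<Longrightarrow> j \<noteq> c \<Longrightarrow> a i j = 0"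
proof -
  define tri where "tri \<longleftrightarrow> (\<exists>x y z. x < n \<and> y < n \<and> z < n \<and> distinct [x, y, z] \<and>
    a x y \<noteq> 0 \<and> a x z \<noteq> 0 \<and> a y z \<noteq> 0)"
  have quad: tri if "i < n" "j < n" "k < n" "l < n" "distinct [i, j, k, l]" "a i j \<noteq> 0" "a k l \<noteq> 0" for i j k l
  proof -
    have "a i l * a k j \<noteq> 0" using rel[of i j k l] that by auto
    moreover have "a i k * a l j \<noteq> 0" using rel[of i j l k] sym[of l k] that by auto
    ultimately show ?thesis unfolding tri_def using that sym
      by (intro exI[of _ i] exI[of _ j] exI[of _ k]) auto
  qed
  show thesis
  proof (cases tri)
    case True
    then obtain x y z where xyz: "x < n" "y < n" "z < n" "x \<noteq> y" "x \<noteq> z" "y \<noteq> z"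
      and nz: "a x y \<noteq> 0" "a x z \<noteq> 0" "a y z \<noteq> 0"
      unfolding tri_def by auto
    \<comment> \<open>If \<open>a i j = u i * u j\<close> off the diagonal, then this quotient is
      the square of \<open>u x\<close>; the triangle makes it well defined and nonzero.\<close>
    define r where "r = csqrt (a x y * a x z / a y z)"
    have r2: "r * r = a x y * a x z / a y z"
      unfolding r_def power2_eq_square[symmetric] by simp
    have r0: "r \<noteq> 0" using r2 nz by auto
    define u where "u i = (if i = x then r else a x i / r)" for i
    have main: "a x i * a x j * a y z = a i j * (a x y * a x z)"
      if ij: "i < n" "j < n" "i \<noteq> j" "i \<noteq> x" "j \<noteq> x" for i j
    proof -
      have aux: "a x i * a x j * a y z = a i j * (a x y * a x z)"
        if ij: "i < n" "j < n" "i \<noteq> j" "i \<noteq> x" "j \<noteq> x" and iz: "i \<noteq> z" and jy: "j \<noteq> y" for i j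
      proof -
        have 1: "a x i * a y z = a x y * a i z"
        proof (cases "i = y")
          case False
          then show ?thesis using rel[of x i z y] sym xyz ij iz by (auto simp: mult.commute)
        qed simp
        have 2: "a x j * a i z = a i j * a x z"
        proof (cases "j = z")
          case False
          then show ?thesis using rel[of x j i z] sym xyz ij iz by (auto simp: mult.commute)
        qed simp
        have "a x i * a x j * a y z = a x j * (a x i * a y z)" by simp
        also have "\<dots> = a x y * (a x j * a i z)" by (simp add: 1)
        finally show ?thesis by (simp add: 2)
      qed
      \<comment> \<open>\<open>aux\<close> applies to \<open>i, j\<close> or, by symmetry, to
        \<open>j, i\<close>; the two remaining cases contradict \<open>i \<noteq> j\<close>.\<close>
      consider "i \<noteq> z" "j \<noteq> y" | "j \<noteq> z" "i \<noteq> y" | "i = z" "j = z" | "i = y" "j = y"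
        using xyz(6) by blast
      then show ?thesis
      proof cases
        case 2
        then show ?thesis using aux[of j i] ij sym[of i j] by (simp add: mult_ac)
      qed (use aux ij in auto)
    qed
    have "a i j = u i * u j" if ij: "i < n" "j < n" "i \<noteq> j" for i j
    proof -
      consider "i = x" | "j = x" | "i \<noteq> x" "j \<noteq> x" by blast
      then show ?thesis
      proof cases
        case 3
        then have "u i * u j = a x i * a x j / (r * r)" by (simp add: u_def)
        also have "\<dots> = a x i * a x j * a y z / (a x y * a x z)" by (simp add: r2)
        also have "\<dots> = a i j" using main[OF ij 3] nz by simp
        finally show ?thesis by simp
      qed (use ij r0 sym in \<open>auto simp: u_def\<close>)
    qed
    then show ?thesis by (rule rank1)
  next
    case False
    show ?thesis
    proof (cases "\<exists>x y. x < n \<and> y < n \<and> x \<noteq> y \<and> a x y \<noteq> 0")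
      case True
      then obtain x y where xy: "x < n" "y < n" "x \<noteq> y" "a x y \<noteq> 0" by blast
      have meet: "i = x \<or> i = y \<or> j = x \<or> j = y" if "i < n" "j < n" "i \<noteq> j" "a i j \<noteq> 0" for i j
        using quad[of x y i j] False xy that by auto
      show ?thesis
      proof (rule ccontr)
        assume no: "\<not> thesis"
        \<comment> \<open>Neither \<open>x\<close> nor \<open>y\<close> is the centre of a star, so
          there is an edge avoiding \<open>x\<close>, which must pass through \<open>y\<close>, and
          one avoiding \<open>y\<close>, which must pass through \<open>x\<close>. If they share an
          end they close a triangle; otherwise they are disjoint and \<open>quad\<close>
          applies.\<close>
        have "\<exists>i j. i < n \<and> j < n \<and> i \<noteq> j \<and> i \<noteq> c \<and> j \<noteq> c \<and> a i j \<noteq> 0" for c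
          using star[of c] no by blast
        then obtain i j i' j' where "i < n" "j < n" "i \<noteq> j" "i \<noteq> x" "j \<noteq> x" "a i j \<noteq> 0"
          and "i' < n" "j' < n" "i' \<noteq> j'" "i' \<noteq> y" "j' \<noteq> y" "a i' j' \<noteq> 0" by metis
        then obtain k l where k: "k < n" "k \<noteq> x" "k \<noteq> y" "a y k \<noteq> 0" and l: "l < n" "l \<noteq> x" "l \<noteq> y" "a x l \<noteq> 0"
          using meet[of i j] meet[of i' j'] sym xy by metis
        show False
        proof (cases "k = l")
          case True
          then have tri unfolding tri_def using k l xy
            by (intro exI[of _ x] exI[of _ y] exI[of _ k]) auto
          then show ?thesis using False by simp
        next
          case kl: False
          then show ?thesis using quad[of y k x l] k l xy False by auto
        qed
      qed
    next
      case False
      then show ?thesis using star by blast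
    qed
  qed
qed

section \<open>Forms vanishing on the image and forms vanishing on tangent tensors\<close>

lemma tendsto_pure_tensor:
  assumes "\<And>k. ((\<lambda>s. fst (v s k)) \<longlongrightarrow> fst (v' k)) F" "\<And>k. ((\<lambda>s. snd (v s k)) \<longlongrightarrow> snd (v' k)) F"
  shows "((\<lambda>s. pure_tensor n (v s) I) \<longlongrightarrow> pure_tensor n v' I) F"
proof (cases "I \<subseteq> {..<n}")
  case True
  have "((\<lambda>s. \<Prod>i<n. if i \<in> I then snd (v s i) else fst (v s i)) \<longlongrightarrow>
      (\<Prod>i<n. if i \<in> I then snd (v' i) else fst (v' i))) F"
    using assms by (intro tendsto_prod) auto
  then show ?thesis using True by (simp add: pure_tensor_def)
qed (simp add: pure_tensor_def)

lemma tendsto_tangent_tensor: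
  assumes "\<And>k. ((\<lambda>s. fst (v s k)) \<longlongrightarrow> fst (v' k)) F" "\<And>k. ((\<lambda>s. snd (v s k)) \<longlongrightarrow> snd (v' k)) F"
    and "\<And>k. ((\<lambda>s. fst (w s k)) \<longlongrightarrow> fst (w' k)) F" "\<And>k. ((\<lambda>s. snd (w s k)) \<longlongrightarrow> snd (w' k)) F"
  shows "((\<lambda>s. tangent_tensor n (v s) (w s) I) \<longlongrightarrow> tangent_tensor n v' w' I) F"
  unfolding tangent_tensor_def using assms
  by (intro tendsto_sum tendsto_pure_tensor) (auto simp: fun_upd_def)

lemma poly_eval_limit_eq_0:
  assumes "\<And>I. ((\<lambda>s. \<gamma> s I) \<longlongrightarrow> x I) F" "\<forall>\<^sub>F s in F. poly_eval p (\<gamma> s) = 0" "F \<noteq> bot"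
  shows "poly_eval p x = 0"
proof -
  have "((\<lambda>s. poly_eval p (\<gamma> s)) \<longlongrightarrow> 0) F" using assms(2) by (rule tendsto_eventually)
  moreover have "((\<lambda>s. poly_eval p (\<gamma> s)) \<longlongrightarrow> poly_eval p x) F"
    by (rule tendsto_poly_eval[OF assms(1)])
  ultimately show ?thesis using tendsto_unique[OF assms(3)] by blast
qed

text \<open>The scalars \<open>fst (v k)\<close> are pulled out of the pure tensors; in summand
  \<open>i\<close> those with \<open>k \<noteq> i\<close> are moved into \<open>w i\<close>.\<close>

lemma tangent_tensor_normalize:
  assumes "\<And>k. k < n \<Longrightarrow> fst (v k) \<noteq> 0"
  shows "\<exists>d w'. tangent_tensor n v w = tangent_tensor n (\<lambda>k. (1, d k)) w'"
proof (intro exI)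
  let ?d = "\<lambda>k. snd (v k) / fst (v k)"
  let ?w = "\<lambda>i. vcomb (\<Prod>k\<in>{..<n} - {i}. fst (v k)) (w i) 0 (w i)"
  show "tangent_tensor n v w = tangent_tensor n (\<lambda>k. (1, ?d k)) ?w"
  proof (rule tensor_eqI[OF tangent_tensor_in_space tangent_tensor_in_space])
    fix \<phi>
    have "(\<Prod>k\<in>{..<n} - {i}. dot (\<phi> k) (v k)) =
        (\<Prod>k\<in>{..<n} - {i}. fst (v k)) * (\<Prod>k\<in>{..<n} - {i}. dot (\<phi> k) (1, ?d k))" for i
      unfolding prod.distrib[symmetric] using assms
      by (intro prod.cong) (auto simp: dot_def field_simps)
    moreover have "dot x (vcomb c y 0 y) = c * dot x y" for x c y
      by (simp add: dot_def vcomb_def algebra_simps)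
    ultimately show "ev n (tangent_tensor n v w) \<phi> = ev n (tangent_tensor n (\<lambda>k. (1, ?d k)) ?w) \<phi>"
      unfolding ev_tangent_tensor by (intro sum.cong) auto
  qed
qed

text \<open>A tangent tensor at \<open>\<Otimes>(1, d\<^sub>k)\<close> is, up to the factor \<open>\<alpha>\<close>, the tensor of principal minors of
  \<open>D + u u\<^sup>T\<close>.\<close>

lemma tangent_tensor_is_principal_minor_tensor:
  assumes "(\<Sum>i<n. fst (w i)) \<noteq> 0"
  shows "\<exists>A c. A \<in> symmetric_mats n \<and> E_rank A \<le> 1 \<and> c \<noteq> 0 \<and>
    tangent_tensor n (\<lambda>k. (1, d k)) w = (\<lambda>I. c * principal_minor_tensor n A 1 I)"
proof -
  let ?v = "\<lambda>k. (1, d k)"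
  let ?\<alpha> = "\<Sum>i<n. fst (w i)"
  \<comment> \<open>The vector \<open>w i\<close> is a multiple of \<open>(1, d i)\<close> plus a
    multiple of \<open>(0, 1)\<close>. The first parts sum to \<open>?\<alpha>\<close> times the
    pure tensor; dividing the second by \<open>?\<alpha>\<close> and taking a square root gives
    \<open>u i\<close>.\<close>
  define u where "u i = csqrt ((snd (w i) - fst (w i) * d i) / ?\<alpha>)" for i
  define A where "A = mat n n (\<lambda>(i, j). (if i = j then d i else 0) + u i * u j)"
  have A: "A \<in> carrier_mat n n" and Aij: "\<And>i j. i < n \<Longrightarrow> j < n \<Longrightarrow> A $$ (i, j) = (if i = j then d i else 0) + u i * u j"
    by (simp_all add: A_def)
  have sym: "A \<in> symmetric_mats n"
    by (auto simp: symmetric_mats_def A_def intro!: eq_matI)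
  have rank: "E_rank A \<le> 1" by (rule E_rank_le_1I[OF A]) (simp add: Aij)
  have w: "w i = vcomb (fst (w i)) (?v i) ?\<alpha> (0, (u i)\<^sup>2)" for i
    using assms by (simp add: vcomb_def u_def prod_eq_iff)
  have "tangent_tensor n ?v w I = ?\<alpha> * principal_minor_tensor n A 1 I" for I
  proof -
    have "tangent_tensor n ?v w I = (\<Sum>i<n. pure_tensor n (?v(i := vcomb (fst (w i)) (?v i) ?\<alpha> (0, (u i)\<^sup>2))) I)"
      unfolding tangent_tensor_def using w by (intro sum.cong) (auto simp only: )
    also have "\<dots> = (\<Sum>i<n. fst (w i) * pure_tensor n ?v I + ?\<alpha> * pure_tensor n (?v(i := (0, (u i)\<^sup>2))) I)"
      by (intro sum.cong) (simp_all only: pure_tensor_upd_linear lessThan_iff fun_upd_idem)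
    also have "\<dots> = ?\<alpha> * (pure_tensor n ?v I + tangent_tensor n ?v (\<lambda>i. (0, (u i)\<^sup>2)) I)"
      by (simp only: tangent_tensor_def sum.distrib distrib_left sum_distrib_right sum_distrib_left)
    finally show ?thesis by (simp only: principal_minor_tensor_diag_plus_rank1[OF A Aij])
  qed
  then show ?thesis using sym rank assms by blast
qed

text \<open>Generic tangent tensors are multiples of principal minor tensors with
  \<open>t = 1\<close>. The others are limits of these in the ordinary topology, in which
  polynomials are continuous.\<close>

lemma form_vanishing_on_image_vanishes_on_tangent_tensors:
  assumes "n \<ge> 1"
    and p: "\<And>A c. A \<in> symmetric_mats n \<Longrightarrow> E_rank A \<le> 1 \<Longrightarrow> c \<noteq> 0 \<Longrightarrow>
      poly_eval p (\<lambda>I. c * principal_minor_tensor n A 1 I) = 0"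
  shows "poly_eval p (tangent_tensor n v w) = 0"
proof -
  have 1: "poly_eval p (tangent_tensor n (\<lambda>k. (1, d k)) w) = 0" if "(\<Sum>i<n. fst (w i)) \<noteq> 0" for d w
    using tangent_tensor_is_principal_minor_tensor[OF that, of d] p by auto
  have 2: "poly_eval p (tangent_tensor n (\<lambda>k. (1, d k)) w) = 0" for d w
  proof (cases "(\<Sum>i<n. fst (w i)) = 0")
    case True
    \<comment> \<open>Perturbing one entry of \<open>w 0\<close> turns the vanishing sum of first
      coordinates into \<open>s\<close>.\<close>
    let ?w = "\<lambda>s :: complex. w(0 := (fst (w 0) + s, snd (w 0)))"
    have tw: "((\<lambda>s. fst (?w s k)) \<longlongrightarrow> fst (w k)) (at 0)" "((\<lambda>s. snd (?w s k)) \<longlongrightarrow> snd (w k)) (at 0)" for k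
      by (cases "k = 0"; auto intro!: tendsto_eq_intros)+
    show ?thesis
    proof (rule poly_eval_limit_eq_0)
      show "((\<lambda>s. tangent_tensor n (\<lambda>k. (1, d k)) (?w s) I) \<longlongrightarrow> tangent_tensor n (\<lambda>k. (1, d k)) w I) (at 0)" for I
        by (intro tendsto_tangent_tensor tw) auto
      have "(\<Sum>i<n. fst (?w s i)) = s" for s
      proof -
        have "(\<Sum>i<n. fst (?w s i)) = (\<Sum>i<n. fst (w i) + (if i = 0 then s else 0))"
          by (intro sum.cong) auto
        then show ?thesis using True assms(1) by (simp add: sum.distrib)
      qed
      then have "poly_eval p (tangent_tensor n (\<lambda>k. (1, d k)) (?w s)) = 0" if "s \<noteq> 0" for s
        using 1[of "?w s" d] that by simp
      then show "\<forall>\<^sub>F s in at 0. poly_eval p (tangent_tensor n (\<lambda>k. (1, d k)) (?w s)) = 0"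
        by (simp add: eventually_at_filter)
    qed simp
  qed (rule 1)
  have 3: "poly_eval p (tangent_tensor n v w) = 0" if "\<And>k. k < n \<Longrightarrow> fst (v k) \<noteq> 0" for v
    using tangent_tensor_normalize[of n v w] that 2 by metis
  \<comment> \<open>For all small nonzero \<open>s\<close> the shifted first coordinates are nonzero
    simultaneously, since there are finitely many.\<close>
  let ?v = "\<lambda>s k. (fst (v k) + s, snd (v k))"
  show ?thesis
  proof (rule poly_eval_limit_eq_0)
    have "((\<lambda>s. fst (?v s k)) \<longlongrightarrow> fst (v k)) (at 0)" for k
      by (auto intro!: tendsto_eq_intros)
    then show "((\<lambda>s. tangent_tensor n (?v s) w I) \<longlongrightarrow> tangent_tensor n v w I) (at 0)" for I
      by (intro tendsto_tangent_tensor) auto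
    have "\<forall>\<^sub>F s in at 0. fst (v k) + s \<noteq> 0" for k
      using eventually_neq_at_within[of "- fst (v k)" 0 UNIV] by eventually_elim (auto simp: add_eq_0_iff2)
    then have "\<forall>\<^sub>F s in at 0. \<forall>k\<in>{..<n}. fst (v k) + s \<noteq> 0"
      by (intro eventually_ball_finite) auto
    then show "\<forall>\<^sub>F s in at 0. poly_eval p (tangent_tensor n (?v s) w) = 0"
      by eventually_elim (rule 3, auto)
  qed simp
qed

text \<open>By the Leibniz formula the minors are polynomials in the matrix entries, hence
  continuous.\<close>

lemma tendsto_principal_minor_tensor:
  assumes "\<And>s. A s \<in> carrier_mat n n" "B \<in> carrier_mat n n"
    and lim: "\<And>i j. i < n \<Longrightarrow> j < n \<Longrightarrow> ((\<lambda>s. A s $$ (i, j)) \<longlongrightarrow> B $$ (i, j)) F"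
  shows "((\<lambda>s. principal_minor_tensor n (A s) t I) \<longlongrightarrow> principal_minor_tensor n B t I) F"
proof (cases "I \<subseteq> {..<n}")
  case True
  let ?m = "card I"
  have lt: "pick I i < n" if "i < ?m" for i using pick_in_set_le[OF that] True by auto
  have det: "minor_det C I I = (\<Sum>p | p permutes {0..<?m}. signof p * (\<Prod>i = 0..<?m. C $$ (pick I i, pick I (p i))))"
    if "C \<in> carrier_mat n n" for C :: "complex mat"
  proof -
    have "minor_det C I I = (\<Sum>p | p permutes {0..<?m}. signof p * (\<Prod>i = 0..<?m.
        mat ?m ?m (\<lambda>(i, j). C $$ (pick I i, pick I j)) $$ (i, p i)))"
      unfolding minor_det_def submatrix_mat[OF that True True] by (rule det_def') simp
    also have "\<dots> = (\<Sum>p | p permutes {0..<?m}. signof p * (\<Prod>i = 0..<?m. C $$ (pick I i, pick I (p i))))"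
    proof (intro sum.cong refl arg_cong2[where f = "(*)"] prod.cong)
      fix p i assume "p \<in> {p. p permutes {0..<?m}}" "i \<in> {0..<?m}"
      then show "mat ?m ?m (\<lambda>(i, j). C $$ (pick I i, pick I j)) $$ (i, p i) = C $$ (pick I i, pick I (p i))"
        using permutes_in_image[of p "{0..<?m}" i] by simp
    qed
    finally show ?thesis .
  qed
  have "((\<lambda>s. minor_det (A s) I I) \<longlongrightarrow> minor_det B I I) F"
    unfolding det[OF assms(1)] det[OF assms(2)]
  proof (intro tendsto_sum tendsto_mult tendsto_const tendsto_prod)
    fix p i assume "p \<in> {p. p permutes {0..<?m}}" "i \<in> {0..<?m}"
    then have "pick I i < n" "pick I (p i) < n"
      using permutes_in_image[of p "{0..<?m}" i] lt by auto
    then show "((\<lambda>s. A s $$ (pick I i, pick I (p i))) \<longlongrightarrow> B $$ (pick I i, pick I (p i))) F" by (rule lim)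
  qed
  then show ?thesis using True by (simp add: principal_minor_tensor_def tendsto_mult_left)
qed (simp add: principal_minor_tensor_def)

text \<open>If the nonzero off-diagonal entries of \<open>A\<close> form a star with centre \<open>c\<close>, then \<open>A\<close> is the limit,
  as \<open>s \<rightarrow> 0\<close>, of matrices with off-diagonal part \<open>u u\<^sup>T\<close>, where \<open>u\<^sub>c = 1 / s\<close> and \<open>u\<^sub>i = s A\<^sub>c\<^sub>i\<close>.\<close>

lemma form_vanishing_on_tangent_tensors_vanishes_on_image:
  assumes n: "n \<ge> 1" and p: "\<And>v w. poly_eval p (tangent_tensor n v w) = 0"
    and A: "A \<in> symmetric_mats n" "E_rank A \<le> 1"
  shows "poly_eval p (\<lambda>I. c * principal_minor_tensor n A t I) = 0"
proof -
  have Ac: "A \<in> carrier_mat n n" using A by (simp add: symmetric_mats_def)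
  have sym: "A $$ (i, j) = A $$ (j, i)" if "i < n" "j < n" for i j
  proof -
    have "transpose_mat A $$ (i, j) = A $$ (j, i)" using Ac that by simp
    then show ?thesis using A(1) by (simp add: symmetric_mats_def)
  qed
  have rank1: "poly_eval p (\<lambda>I. c * principal_minor_tensor n B t I) = 0"
    if B: "B \<in> carrier_mat n n" "\<And>i j. i < n \<Longrightarrow> j < n \<Longrightarrow> i \<noteq> j \<Longrightarrow> B $$ (i, j) = u i * u j" for B u
  proof -
    obtain v w where "principal_minor_tensor n B t = tangent_tensor n v w"
      using principal_minor_tensor_rank1_is_tangent[OF n B] by blast
    moreover obtain w' where "(\<lambda>I. c * tangent_tensor n v w I) = tangent_tensor n v w'"
      using scale_tangent_tensor[OF n] by blast
    ultimately show ?thesis using p by simp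
  qed
  show ?thesis
  proof (rule off_diagonal_rank1_cases[of n "\<lambda>i j. A $$ (i, j)"])
    show "A $$ (i, j) = A $$ (j, i)" if "i < n" "j < n" for i j by (rule sym[OF that])
    show "A $$ (i, j) * A $$ (k, l) = A $$ (i, l) * A $$ (k, j)"
      if "i < n" "j < n" "k < n" "l < n" "distinct [i, j, k, l]" for i j k l
      by (rule E_rank_le_1D[OF Ac A(2) that])
  next
    fix u assume "\<And>i j. i < n \<Longrightarrow> j < n \<Longrightarrow> i \<noteq> j \<Longrightarrow> A $$ (i, j) = u i * u j"
    then show ?thesis using rank1[OF Ac] by blast
  next
    fix m assume star: "\<And>i j. i < n \<Longrightarrow> j < n \<Longrightarrow> i \<noteq> j \<Longrightarrow> i \<noteq> m \<Longrightarrow> j \<noteq> m \<Longrightarrow> A $$ (i, j) = 0"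
    define u where "u s i = (if i = m then 1 / s else s * A $$ (m, i))" for s i
    \<comment> \<open>The diagonal is copied from \<open>A\<close>. For \<open>s \<noteq> 0\<close>
      row and column \<open>m\<close> agree exactly with \<open>A\<close>; the other off-diagonal
      entries are of order \<open>s^2\<close>, while those of \<open>A\<close> are 0.\<close>
    define B where "B s = mat n n (\<lambda>(i, j). if i = j then A $$ (i, i) else u s i * u s j)" for s
    show ?thesis
    proof (rule poly_eval_limit_eq_0)
      have "((\<lambda>s. B s $$ (i, j)) \<longlongrightarrow> A $$ (i, j)) (at 0)" if ij: "i < n" "j < n" for i j
      proof -
        consider "i = j" | "i \<noteq> j" "i = m \<or> j = m" | "i \<noteq> j" "i \<noteq> m" "j \<noteq> m" by blast
        then show ?thesis
        proof cases
          case 1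
          then show ?thesis using ij by (simp add: B_def)
        next
          case 2
          then have "B s $$ (i, j) = A $$ (i, j)" if "s \<noteq> 0" for s
            using ij that sym by (auto simp: B_def u_def)
          then show ?thesis by (intro tendsto_eventually) (simp add: eventually_at_filter)
        next
          case 3
          have "((\<lambda>s. s * A $$ (m, i) * (s * A $$ (m, j))) \<longlongrightarrow> 0) (at 0)"
            by (auto intro!: tendsto_eq_intros)
          then show ?thesis using 3 ij star by (simp add: B_def u_def)
        qed
      qed
      then show "((\<lambda>s. c * principal_minor_tensor n (B s) t I) \<longlongrightarrow> c * principal_minor_tensor n A t I) (at 0)" for I
        by (intro tendsto_mult_left tendsto_principal_minor_tensor) (use Ac in \<open>auto simp: B_def\<close>)
      show "\<forall>\<^sub>F s in at 0. poly_eval p (\<lambda>I. c * principal_minor_tensor n (B s) t I) = 0"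
        by (intro always_eventually allI rank1[where u = "u s" for s]) (auto simp: B_def)
    qed simp
  qed
qed

section \<open>Tangent spaces of the Segre variety\<close>

lemma Union_segre_varietyE:
  assumes "x \<in> \<Union>(segre_variety n)"
  obtains c v where "c \<noteq> 0" "\<And>k. k < n \<Longrightarrow> v k \<noteq> (0, 0)" "x = (\<lambda>I. c * pure_tensor n v I)"
  using assms by (auto simp: segre_variety_def proj_point_def)

lemma pure_tensor_in_segre:
  assumes "\<And>k. k < n \<Longrightarrow> v k \<noteq> (0, 0)"
  shows "pure_tensor n v \<in> \<Union>(segre_variety n)"
proof -
  have "pure_tensor n v \<in> proj_point (pure_tensor n v)"
    unfolding proj_point_def using one_neq_zero[where 'a = complex] by force
  then show ?thesis using assms by (auto simp: segre_variety_def)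
qed

text \<open>The curve of pure tensors with factors \<open>v k + s * w k\<close> stays in the cone
  over the Segre variety for small \<open>s\<close> and has this tangent tensor as velocity.\<close>

lemma tangent_tensor_in_affine_tangent_space:
  assumes v: "\<And>k. k < n \<Longrightarrow> v k \<noteq> (0, 0)"
  shows "tangent_tensor n v w \<in> affine_tangent_space n (segre_variety n) (pure_tensor n v)"
  unfolding affine_tangent_space_def
proof (intro CollectI conjI ballI tangent_tensor_in_space)
  fix p assume p: "p \<in> vanishing_forms n (segre_variety n)"
  obtain D where D: "\<And>\<gamma>. \<gamma> 0 = pure_tensor n v \<Longrightarrow>
    (\<And>I. ((\<lambda>s. \<gamma> s I) has_field_derivative tangent_tensor n v w I) (at 0)) \<Longrightarrow>
    ((\<lambda>s. poly_eval p (\<gamma> s)) has_field_derivative D) (at 0)"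
    using poly_eval_curve_derivative by blast
  let ?v = "\<lambda>s k. vcomb 1 (v k) s (w k)"
  have "((\<lambda>s. poly_eval p (pure_tensor n (?v s))) has_field_derivative D) (at 0)"
  proof (rule D)
    show "pure_tensor n (?v 0) = pure_tensor n v" by (simp add: vcomb_def)
    fix I
    show "((\<lambda>s. pure_tensor n (?v s) I) has_field_derivative tangent_tensor n v w I) (at 0)"
    proof (cases "I \<subseteq> {..<n}")
      case True
      have "((\<lambda>s. \<Prod>k<n. if k \<in> I then snd (?v s k) else fst (?v s k)) has_field_derivative
          (\<Sum>k<n. (if k \<in> I then snd (w k) else fst (w k)) *
            (\<Prod>i\<in>{..<n} - {k}. if i \<in> I then snd (?v 0 i) else fst (?v 0 i)))) (at 0)"
        by (rule has_field_derivative_prod) (auto simp: vcomb_def intro!: derivative_eq_intros)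
      moreover have "tangent_tensor n v w I = (\<Sum>k<n. (if k \<in> I then snd (w k) else fst (w k)) *
            (\<Prod>i\<in>{..<n} - {k}. if i \<in> I then snd (?v 0 i) else fst (?v 0 i)))"
        unfolding tangent_tensor_def
        by (intro sum.cong) (simp_all add: pure_tensor_upd True vcomb_def cong: if_cong)
      ultimately show ?thesis using True by (simp add: pure_tensor_def)
    qed (simp add: pure_tensor_def tangent_tensor_def)
  qed
  moreover have "\<forall>\<^sub>F s in nhds 0. poly_eval p (pure_tensor n (?v s)) = 0"
  proof -
    have "\<forall>\<^sub>F s in nhds 0. ?v s k \<noteq> (0, 0)" if "k < n" for k
    proof -
      have "((\<lambda>s. 1 * fst (v k) + s * fst (w k)) \<longlongrightarrow> fst (v k)) (nhds 0)"
        "((\<lambda>s. 1 * snd (v k) + s * snd (w k)) \<longlongrightarrow> snd (v k)) (nhds 0)"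
        by (auto intro!: tendsto_eq_intros filterlim_ident)
      moreover have "fst (v k) \<noteq> 0 \<or> snd (v k) \<noteq> 0" using v[OF that] by (auto simp: prod_eq_iff)
      ultimately have "(\<forall>\<^sub>F s in nhds 0. 1 * fst (v k) + s * fst (w k) \<noteq> 0) \<or>
          (\<forall>\<^sub>F s in nhds 0. 1 * snd (v k) + s * snd (w k) \<noteq> 0)"
        using tendsto_imp_eventually_ne by blast
      then show ?thesis
        by (auto simp: vcomb_def elim: eventually_mono)
    qed
    then have "\<forall>\<^sub>F s in nhds 0. \<forall>k\<in>{..<n}. ?v s k \<noteq> (0, 0)"
      by (intro eventually_ball_finite) auto
    then show ?thesis
    proof eventually_elim
      case (elim s)
      then have "pure_tensor n (?v s) \<in> \<Union>(segre_variety n)" by (intro pure_tensor_in_segre) auto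
      then show ?case using p unfolding vanishing_forms_def by blast
    qed
  qed
  \<comment> \<open>Along the curve the form is 0 near \<open>s = 0\<close>, so
    \<open>D = 0\<close>; the same \<open>D\<close> is the derivative along the straight
    line.\<close>
  ultimately have "((\<lambda>s. 0) has_field_derivative D) (at (0 :: complex))"
    by (subst (asm) DERIV_cong_ev[OF refl _ refl]) auto
  then have "D = 0" using DERIV_unique DERIV_const by blast
  then show "((\<lambda>s. poly_eval p (lincomb 1 (pure_tensor n v) s (tangent_tensor n v w))) has_field_derivative 0) (at 0)"
    by (intro D[unfolded \<open>D = 0\<close>]) (auto simp: lincomb_def intro!: derivative_eq_intros)
qed

lemma exists_dual_vectors:
  assumes "\<And>k. k < n \<Longrightarrow> v k \<noteq> (0, 0)"
  obtains p where "\<And>k :: nat. k < n \<Longrightarrow> dot (p k) (v k) = 1"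
proof -
  have "\<forall>k. \<exists>x. k < n \<longrightarrow> dot x (v k) = 1" using exists_dot_eq_1 assms by blast
  then show ?thesis using that by metis
qed

text \<open>Differentiating suitable quadrics through the Segre variety shows that \<open>w\<close>
  vanishes when two arguments are annihilated, which is the hypothesis of
  \<open>tangent_tensorI\<close>.\<close>

lemma affine_tangent_space_segre:
  assumes n: "n \<ge> 1" and c: "c \<noteq> 0" and v: "\<And>k. k < n \<Longrightarrow> v k \<noteq> (0, 0)"
    and w: "w \<in> affine_tangent_space n (segre_variety n) (\<lambda>I. c * pure_tensor n v I)" (is "_ \<in> affine_tangent_space _ _ ?x")
  shows "\<exists>w'. w = tangent_tensor n v w'"
proof -
  obtain p where p: "\<And>k. k < n \<Longrightarrow> dot (p k) (v k) = 1"
    using exists_dual_vectors[of n v] v by blast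
  show ?thesis
  proof (rule tangent_tensorI[OF n _ p])
    show "w \<in> tensor_space n" using w by (simp add: affine_tangent_space_def)
    fix \<psi> k l assume kl: "k < n" "l < n" "k \<noteq> l" "dot (\<psi> k) (v k) = 0" "dot (\<psi> l) (v l) = 0"
    \<comment> \<open>Exchanging the arguments in factor \<open>k\<close> does not change the
      product of two values of a pure tensor. At the base point the three values other than
      \<open>ev n ?x p = c\<close> vanish, so the derivative of this quadric is
      \<open>c * ev n w \<psi>\<close>.\<close>
    let ?f = "\<lambda>T. ev n T p * ev n T \<psi> - ev n T (p(k := \<psi> k)) * ev n T (\<psi>(k := p k))"
    have form: "form_fun n (1 + 1) ?f"
      by (intro form_fun_diff form_fun.mult form_fun_ev_const)
    have vanish: "?f T = 0" if T: "T \<in> \<Union>(segre_variety n)" for T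
    proof -
      obtain b u where T: "T = (\<lambda>I. b * pure_tensor n u I)" using Union_segre_varietyE[OF T] by metis
      have upd: "(\<Prod>m<n. dot ((\<phi>(k := x)) m) (u m)) = dot x (u k) * (\<Prod>m\<in>{..<n} - {k}. dot (\<phi> m) (u m))" for \<phi> x
      proof -
        have "(\<Prod>m<n. dot ((\<phi>(k := x)) m) (u m)) = dot x (u k) * (\<Prod>m\<in>{..<n} - {k}. dot ((\<phi>(k := x)) m) (u m))"
          using kl(1) by (subst prod.remove[of _ k]) auto
        also have "(\<Prod>m\<in>{..<n} - {k}. dot ((\<phi>(k := x)) m) (u m)) = (\<Prod>m\<in>{..<n} - {k}. dot (\<phi> m) (u m))"
          by (intro prod.cong) auto
        finally show ?thesis .
      qed
      show ?thesis
        unfolding T ev_scale ev_pure upd using upd[of p "p k"] upd[of \<psi> "\<psi> k"] by (simp add: mult_ac)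
    qed
    obtain q where q: "q \<in> vanishing_forms n (segre_variety n)" "poly_eval q = ?f"
      using form_fun_vanishing[OF form vanish] by blast
    have "((\<lambda>s. poly_eval q (lincomb 1 ?x s w)) has_field_derivative 0) (at 0)"
      using w q(1) by (simp add: affine_tangent_space_def)
    moreover have "((\<lambda>s. poly_eval q (lincomb 1 ?x s w)) has_field_derivative
      (ev n ?x p * ev n w \<psi> + ev n w p * ev n ?x \<psi> -
       (ev n ?x (p(k := \<psi> k)) * ev n w (\<psi>(k := p k)) + ev n w (p(k := \<psi> k)) * ev n ?x (\<psi>(k := p k))))) (at 0)"
      unfolding q(2) ev_lincomb by (auto intro!: derivative_eq_intros)
    ultimately have eq: "ev n ?x p * ev n w \<psi> + ev n w p * ev n ?x \<psi> -
       (ev n ?x (p(k := \<psi> k)) * ev n w (\<psi>(k := p k)) + ev n w (p(k := \<psi> k)) * ev n ?x (\<psi>(k := p k))) = 0"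
      using DERIV_unique by blast
    have "ev n ?x p = c" using p by (simp add: ev_scale ev_pure)
    moreover have "ev n ?x \<phi> = 0" if "m < n" "dot (\<phi> m) (v m) = 0" for \<phi> m
      using that by (auto simp: ev_scale ev_pure)
    note this[OF kl(1), of \<psi>] this[OF kl(1), of "p(k := \<psi> k)"] this[OF kl(2), of "\<psi>(k := p k)"]
    ultimately show "ev n w \<psi> = 0" using eq kl c by simp
  qed
qed

section \<open>Tangent tensors as points of tangent lines\<close>

lemma pure_tensor_eq_0_iff:
  "pure_tensor n v = (\<lambda>_. 0) \<longleftrightarrow> (\<exists>k<n. v k = (0, 0))"
proof
  assume 0: "pure_tensor n v = (\<lambda>_. 0)"
  show "\<exists>k<n. v k = (0, 0)"
  proof (rule ccontr)
    assume "\<not> ?thesis"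
    then obtain p where "\<And>k. k < n \<Longrightarrow> dot (p k) (v k) = 1"
      using exists_dual_vectors[of n v] by blast
    then have "ev n (pure_tensor n v) p = 1" by (simp add: ev_pure)
    then show False by (simp add: 0 ev_def)
  qed
next
  assume "\<exists>k<n. v k = (0, 0)"
  then obtain k where k: "k < n" "v k = (0, 0)" by blast
  have "(\<Prod>i<n. if i \<in> I then snd (v i) else fst (v i)) = 0" for I
    by (rule prod_zero) (use k in \<open>auto intro!: bexI[of _ k]\<close>)
  then show "pure_tensor n v = (\<lambda>_. 0)" by (simp only: pure_tensor_def if_cancel)
qed

lemma proj_point_in_proj_line:
  assumes "lincomb a x b w = y" "y \<noteq> (\<lambda>_. 0)"
  shows "proj_point y \<in> proj_line x w"
  using assms unfolding proj_line_def by blast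

text \<open>The line joining the base point to the tangent tensor is a tangent line unless the two
  are proportional. In that case the point is the base point itself, and any tangent line through it
  serves.\<close>

lemma tangent_tensor_on_tangent_line:
  assumes n: "n \<ge> 1" and v: "\<And>k. k < n \<Longrightarrow> v k \<noteq> (0, 0)" and nz: "tangent_tensor n v w \<noteq> (\<lambda>_. 0)"
  shows "proj_point (tangent_tensor n v w) \<in> tangential_variety n (segre_variety n)"
proof -
  let ?x = "pure_tensor n v" and ?T = "tangent_tensor n v w"
  have "\<exists>w'. (\<forall>a b. lincomb a ?x b (tangent_tensor n v w') = (\<lambda>_. 0) \<longrightarrow> a = 0 \<and> b = 0) \<and>
    proj_point ?T \<in> proj_line ?x (tangent_tensor n v w')"
  proof (cases "\<forall>a b. lincomb a ?x b ?T = (\<lambda>_. 0) \<longrightarrow> a = 0 \<and> b = 0")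
    case True
    have "lincomb 0 ?x 1 ?T = ?T" by (simp add: lincomb_def)
    then have "proj_point ?T \<in> proj_line ?x ?T" using nz by (rule proj_point_in_proj_line)
    then show ?thesis using True by blast
  next
    case False
    have x0: "?x \<noteq> (\<lambda>_. 0)" using v by (simp add: pure_tensor_eq_0_iff)
    obtain a b where ab: "lincomb a ?x b ?T = (\<lambda>_. 0)" "a \<noteq> 0 \<or> b \<noteq> 0" using False by blast
    have "b \<noteq> 0"
    proof
      assume "b = 0"
      then have "?x = (\<lambda>_. 0)" using ab by (auto simp: lincomb_def fun_eq_iff)
      then show False using x0 by simp
    qed
    have T: "?T = (\<lambda>I. - a / b * ?x I)"
    proof
      fix I
      have "a * ?x I + b * ?T I = 0" using ab(1) by (auto simp: lincomb_def fun_eq_iff)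
      then show "?T I = - a / b * ?x I" using \<open>b \<noteq> 0\<close> by (simp add: field_simps add_eq_0_iff)
    qed
    \<comment> \<open>A vector independent of \<open>v 0\<close>, so that replacing
      \<open>v 0\<close> by \<open>u\<close> gives a tangent direction independent of the base
      point.\<close>
    define u where "u = (if fst (v 0) = 0 then (1, 0) else (0 :: complex, 1 :: complex))"
    obtain w' where "lincomb 0 ?x 1 (tangent_tensor n v (\<lambda>i. if i = 0 then u else (0, 0))) = tangent_tensor n v w'"
      using lincomb_pure_tangent_tensor[OF n] by blast
    moreover have "tangent_tensor n v (\<lambda>i. if i = 0 then u else (0, 0)) = pure_tensor n (v(0 := u))"
    proof
      fix I
      have "tangent_tensor n v (\<lambda>i. if i = 0 then u else (0, 0)) I =
          (\<Sum>i<n. if i = 0 then pure_tensor n (v(0 := u)) I else 0)"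
        unfolding tangent_tensor_def
      proof (intro sum.cong refl)
        fix i assume "i \<in> {..<n}"
        then have "pure_tensor n (v(i := (0, 0))) = (\<lambda>_. 0)"
          by (subst pure_tensor_eq_0_iff) auto
        then show "pure_tensor n (v(i := if i = 0 then u else (0, 0))) I = (if i = 0 then pure_tensor n (v(0 := u)) I else 0)"
          by (simp add: fun_eq_iff)
      qed
      then show "tangent_tensor n v (\<lambda>i. if i = 0 then u else (0, 0)) I = pure_tensor n (v(0 := u)) I"
        using n by simp
    qed
    ultimately have w': "tangent_tensor n v w' = pure_tensor n (v(0 := u))"
      by (simp add: lincomb_def)
    have "a = 0 \<and> b = 0" if "lincomb a ?x b (tangent_tensor n v w') = (\<lambda>_. 0)" for a b
    proof -
      have "lincomb a ?x b (tangent_tensor n v w') = pure_tensor n (v(0 := vcomb a (v 0) b u))"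
        using n by (simp add: lincomb_def w' fun_eq_iff pure_tensor_upd_linear fun_upd_triv)
      then have "pure_tensor n (v(0 := vcomb a (v 0) b u)) = (\<lambda>_. 0)" using that by simp
      then obtain k where "k < n" "(v(0 := vcomb a (v 0) b u)) k = (0, 0)"
        unfolding pure_tensor_eq_0_iff by blast
      then have "vcomb a (v 0) b u = (0, 0)" using v by (cases "k = 0") auto
      moreover have "v 0 \<noteq> (0, 0)" using v n by simp
      ultimately show ?thesis by (cases "v 0") (auto simp: u_def vcomb_def split: if_splits)
    qed
    moreover have "lincomb (- a / b) ?x 0 (tangent_tensor n v w') = ?T" by (simp add: lincomb_def T)
    then have "proj_point ?T \<in> proj_line ?x (tangent_tensor n v w')"
      using nz by (rule proj_point_in_proj_line)
    ultimately show ?thesis by blast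
  qed
  then obtain w' where w': "\<forall>a b. lincomb a ?x b (tangent_tensor n v w') = (\<lambda>_. 0) \<longrightarrow> a = 0 \<and> b = 0"
    "proj_point ?T \<in> proj_line ?x (tangent_tensor n v w')" by blast
  have "proj_line ?x (tangent_tensor n v w') \<in> embedded_tangent_lines n (segre_variety n)"
  proof -
    have "?x \<in> \<Union>(segre_variety n)" by (rule pure_tensor_in_segre) (rule v)
    moreover have "tangent_tensor n v w' \<in> affine_tangent_space n (segre_variety n) ?x"
      by (rule tangent_tensor_in_affine_tangent_space) (rule v)
    ultimately show ?thesis unfolding embedded_tangent_lines_def using w'(1) by blast
  qed
  then show ?thesis using w'(2) unfolding tangential_variety_def by blast
qed

theorem proposition5p2:
  fixes n :: nat
  assumes "n \<ge> 1"
  shows "tangential_variety n (segre_variety n) =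
    zariski_closure n (principal_minor_map n `
      {proj_pair A t | A t. A \<in> symmetric_mats n \<and> t \<noteq> 0 \<and> E_rank A \<le> 1})"
    (is "?\<tau> = zariski_closure n ?Im")
proof -
  \<comment> \<open>The affine cone over the image, given by representatives; forms are tested on
    this set.\<close>
  have Im: "T \<in> \<Union>?Im \<longleftrightarrow> (\<exists>A t c. A \<in> symmetric_mats n \<and> t \<noteq> 0 \<and> E_rank A \<le> 1 \<and> c \<noteq> 0 \<and>
      T = (\<lambda>I. c * principal_minor_tensor n A t I))" for T
  proof -
    have *: "principal_minor_map n (proj_pair A t) = proj_point (principal_minor_tensor n A t)"
      if "A \<in> symmetric_mats n" for A t
      using that principal_minor_map_proj_pair by (simp add: symmetric_mats_def)
    have "T \<in> \<Union>?Im \<longleftrightarrow> (\<exists>A t. A \<in> symmetric_mats n \<and> t \<noteq> 0 \<and> E_rank A \<le> 1 \<and>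
        T \<in> principal_minor_map n (proj_pair A t))" by blast
    also have "\<dots> \<longleftrightarrow> (\<exists>A t. A \<in> symmetric_mats n \<and> t \<noteq> 0 \<and> E_rank A \<le> 1 \<and>
        T \<in> proj_point (principal_minor_tensor n A t))" using * by metis
    finally show ?thesis by (auto simp: proj_point_def)
  qed
  \<comment> \<open>Every nonzero vector representing a point of a tangent line is a tangent tensor,
    and forms vanishing on the image vanish there.\<close>
  have "P \<in> zariski_closure n ?Im" if P\<tau>: "P \<in> ?\<tau>" for P
  proof -
    obtain x w a b where x: "x \<in> \<Union>(segre_variety n)" and w: "w \<in> affine_tangent_space n (segre_variety n) x"
      and P: "P = proj_point (lincomb a x b w)" "lincomb a x b w \<noteq> (\<lambda>_. 0)"
      using P\<tau> unfolding tangential_variety_def embedded_tangent_lines_def proj_line_def by blast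
    obtain c v where c: "c \<noteq> 0" and v: "\<And>k. k < n \<Longrightarrow> v k \<noteq> (0, 0)" and xv: "x = (\<lambda>I. c * pure_tensor n v I)"
      using Union_segre_varietyE[OF x] by metis
    have "w \<in> affine_tangent_space n (segre_variety n) (\<lambda>I. c * pure_tensor n v I)" using w xv by simp
    then obtain w1 where w1: "w = tangent_tensor n v w1"
      using affine_tangent_space_segre[of n c v w] assms c v by blast
    have "lincomb a x b w = lincomb (a * c) (pure_tensor n v) b (tangent_tensor n v w1)"
      by (simp add: lincomb_def xv w1 mult.assoc)
    then obtain w2 where w2: "lincomb a x b w = tangent_tensor n v w2"
      using lincomb_pure_tangent_tensor[OF assms] by metis
    have "P \<in> proj_space n" unfolding proj_space_def using P w2 tangent_tensor_in_space by auto
    moreover have "poly_eval p y = 0" if p: "p \<in> vanishing_forms n ?Im" and y: "y \<in> P" for p y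
    proof -
      obtain w3 where "y = tangent_tensor n v w3"
        using y P w2 scale_tangent_tensor[OF assms] unfolding proj_point_def by fastforce
      moreover have "poly_eval p (tangent_tensor n v w3) = 0"
      proof (rule form_vanishing_on_image_vanishes_on_tangent_tensors[OF assms])
        fix A c assume "A \<in> symmetric_mats n" "E_rank A \<le> 1" "c \<noteq> (0 :: complex)"
        then have "(\<lambda>I. c * principal_minor_tensor n A 1 I) \<in> \<Union>?Im"
          unfolding Im using one_neq_zero[where 'a = complex] by blast
        then show "poly_eval p (\<lambda>I. c * principal_minor_tensor n A 1 I) = 0"
          using p unfolding vanishing_forms_def by blast
      qed
      ultimately show ?thesis by simp
    qed
    ultimately show ?thesis unfolding zariski_closure_def by blast
  qed
  moreover have "P \<in> ?\<tau>" if P: "P \<in> zariski_closure n ?Im" for P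
  proof -
    obtain T where T: "P = proj_point T" "T \<in> tensor_space n" "T \<noteq> (\<lambda>_. 0)"
      using P by (auto simp: zariski_closure_def proj_space_def)
    have "T \<in> P" unfolding T(1) proj_point_def using one_neq_zero[where 'a = complex] by force
    \<comment> \<open>A form vanishing on all tangent tensors vanishes on the image and therefore on
      its closure, so \<open>T\<close> satisfies all the equations from which \<open>v\<close> and
      \<open>w\<close> are recovered.\<close>
    have "f T = 0" if f: "form_fun n d f" and f0: "\<forall>v w. f (tangent_tensor n v w) = 0" for d f
    proof -
      obtain q where q: "poly_eval q = f" using form_fun_imp_form[OF f] by blast
      have "f y = 0" if "y \<in> \<Union>?Im" for y
        using that form_vanishing_on_tangent_tensors_vanishes_on_image[OF assms, of q] f0 unfolding Im q by blast
      then obtain r where "r \<in> vanishing_forms n ?Im" "poly_eval r = f"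
        using form_fun_vanishing[OF f] by blast
      then show ?thesis using P \<open>T \<in> P\<close> unfolding zariski_closure_def by blast
    qed
    then have "in_tangent_closure n T" using T(2) by (auto simp: in_tangent_closure_def)
    then obtain v w where "\<forall>k<n. v k \<noteq> (0, 0)" "T = tangent_tensor n v w"
      using closure_is_tangent_tensor[OF assms _ T(3)] by blast
    then show ?thesis using tangent_tensor_on_tangent_line[OF assms, of v w] T by simp
  qed
  ultimately show ?thesis by blast
qed

end
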